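(* Let $r > 1 - 1/d$. Let $f$ be a probability density function on $\mathbb{R}^d$. For any fixed integer $n \geq 2$, the identity $$\sup_{X_i \sim f} h_r\left( \sum_{i=1}^n \lambda_i X_i \right) = h_r(X_1)$$ holds for all $\lambda_i \geq 0$ such that $\sum_{i=1}^n \lambda_i = 1$ if and only if the density $f$ is $(r-1)$-concave.
   Context: The supremum is over all (possibly dependent) random vectors $X_1,\dots,X_n$ in $\mathbb{R}^d$, i.e. over all couplings, such that each $X_i$ has density $f$. For a random vector $X$ in $\mathbb{R}^d$ with density $f$ with respect to Lebesgue measure and $r \in (0,1)\cup(1,\infty)$, the $r$-R\'enyi entropy is $h_r(X) = \frac{1}{1-r}\log \int_{\mathbb{R}^d} f(x)^r\,dx$; for $r=1$, $h_1(X) = -\int_{\mathbb{R}^d} f\log f\,dx$; for $r=0$, $h_0(X)=\log|\mathrm{supp}(f)|$; for $r=\infty$, $h_\infty(X) = -\log\|f\|_\infty$. For $s\in[-\infty,\infty]$, a function $f:\mathbb{R}^d\to[0,\infty)$ is called $s$-concave if $f((1-\lambda)x+\lambda y) \geq ((1-\lambda)f(x)^s+\lambda f(y)^s)^{1/s}$ for all $x,y\in\mathbb{R}^d$ with $f(x)f(y)>0$ and all $\lambda\in(0,1)$; the right-hand side is understood as $\min\{f(x),f(y)\}$ for $s=-\infty$, $f(x)^{1-\lambda}f(y)^\lambda$ for $s=0$ (log-concavity), and $\max\{f(x),f(y)\}$ for $s=\infty$.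
   Formalization: The "only if" part assumes h_r(X_1) is well defined and less than +∞ (if h_r(X_1)=+∞ the identity holds for every f via X_1=…=X_n); "f is (r-1)-concave" means f equals an (r-1)-concave function almost everywhere. *)

theory Defs
  imports "HOL-Probability.Probability"
begin

definition prob_density :: "('a::euclidean_space \<Rightarrow> real) \<Rightarrow> bool" where
  "prob_density f \<longleftrightarrow>
     f \<in> borel_measurable borel \<and> (\<forall>x. 0 \<le> f x) \<and> (\<integral>\<^sup>+ x. ennreal (f x) \<partial>lborel) = 1"

definition ext_ln :: "ennreal \<Rightarrow> ereal" where
  "ext_ln x = (if x = 0 then -\<infinity> else if x = \<infinity> then \<infinity> else ereal (ln (enn2real x)))"

text \<open>
  Entropies take values in the extended reals: the integral of \<open>f powr r\<close> may be infinite, and for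
  order 1 the integral of \<open>- f ln f\<close> is the difference of its positive and its negative part.
  It is undefined precisely when both parts are infinite; \<open>renyi_entropy_defined\<close> rules this out.
  The definition is used for \<open>r > 0\<close>, where \<open>0 powr r = 0\<close> is the correct value off the support
  of \<open>f\<close>; likewise \<open>0 * ln 0 = 0\<close>.
\<close>

definition renyi_entropy_defined :: "real \<Rightarrow> ('a::euclidean_space \<Rightarrow> real) \<Rightarrow> bool" where
  "renyi_entropy_defined r f \<longleftrightarrow>
     (r = 1 \<longrightarrow> (\<integral>\<^sup>+ x. ennreal (- (f x * ln (f x))) \<partial>lborel) < \<infinity>
            \<or> (\<integral>\<^sup>+ x. ennreal (f x * ln (f x)) \<partial>lborel) < \<infinity>)"

definition renyi_entropy :: "real \<Rightarrow> ('a::euclidean_space \<Rightarrow> real) \<Rightarrow> ereal" where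
  "renyi_entropy r f =
     (if r = 1
      then enn2ereal (\<integral>\<^sup>+ x. ennreal (- (f x * ln (f x))) \<partial>lborel)
         - enn2ereal (\<integral>\<^sup>+ x. ennreal (f x * ln (f x)) \<partial>lborel)
      else ereal (1 / (1 - r)) * ext_ln (\<integral>\<^sup>+ x. ennreal (f x powr r) \<partial>lborel))"

text \<open>
  \<open>h\<close> is the entropy of order \<open>r\<close> of the random vector \<open>X\<close>. A random vector without a density
  has no entropy in this sense.
\<close>

definition has_renyi_entropy ::
    "real \<Rightarrow> 'w measure \<Rightarrow> ('w \<Rightarrow> 'a::euclidean_space) \<Rightarrow> ereal \<Rightarrow> bool" where
  "has_renyi_entropy r M X h \<longleftrightarrow>
     (\<exists>g. prob_density g \<and> distributed M lborel X (\<lambda>x. ennreal (g x)) \<and>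
          renyi_entropy_defined r g \<and> h = renyi_entropy r g)"

text \<open>
  A coupling is given by the joint law of \<open>(X\<^sub>1, \<dots>, X\<^sub>n)\<close>, the random vector \<open>X\<^sub>i\<close> being the
  \<open>i\<close>-th coordinate projection.
\<close>

definition couplings :: "nat \<Rightarrow> ('a::euclidean_space \<Rightarrow> real) \<Rightarrow> (nat \<Rightarrow> 'a) measure set" where
  "couplings n f =
     {P. prob_space P \<and> sets P = sets (\<Pi>\<^sub>M i\<in>{1..n}. (borel :: 'a measure)) \<and>
         (\<forall>i\<in>{1..n}. distributed P lborel (\<lambda>X. X i) (\<lambda>x. ennreal (f x)))}"

text \<open>
  Couplings under which the weighted sum has no density, or under which its entropy of order 1 is
  of the form \<open>\<infinity> - \<infinity>\<close>, do not contribute to the supremum.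
\<close>

definition sup_sum_entropy ::
    "real \<Rightarrow> nat \<Rightarrow> ('a::euclidean_space \<Rightarrow> real) \<Rightarrow> (nat \<Rightarrow> real) \<Rightarrow> ereal" where
  "sup_sum_entropy r n f l =
     Sup {h. \<exists>P\<in>couplings n f. has_renyi_entropy r P (\<lambda>X. \<Sum>i=1..n. l i *\<^sub>R X i) h}"

definition weighted_mean :: "real \<Rightarrow> real \<Rightarrow> real \<Rightarrow> real \<Rightarrow> real" where
  "weighted_mean s t a b =
     (if s = 0 then a powr (1 - t) * b powr t
      else ((1 - t) * a powr s + t * b powr s) powr (1 / s))"

definition s_concave :: "real \<Rightarrow> ('a::euclidean_space \<Rightarrow> real) \<Rightarrow> bool" where
  "s_concave s f \<longleftrightarrow>
     (\<forall>x. 0 \<le> f x) \<and>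
     (\<forall>x y t. f x * f y > 0 \<and> 0 < t \<and> t < 1 \<longrightarrow>
        f ((1 - t) *\<^sub>R x + t *\<^sub>R y) \<ge> weighted_mean s t (f x) (f y))"

text \<open>
  A density is determined by its distribution only up to Lebesgue null sets, whereas
  \<open>s_concave\<close> is a pointwise condition.
\<close>

definition s_concave_density :: "real \<Rightarrow> ('a::euclidean_space \<Rightarrow> real) \<Rightarrow> bool" where
  "s_concave_density s f \<longleftrightarrow> (\<exists>g. s_concave s g \<and> (AE x in lborel. f x = g x))"

end

theory Submission
  imports Defs
begin

text \<open>
  Write \<open>s = r - 1\<close> and \<open>d\<close> for the dimension. Let \<open>\<phi>(u)\<close> be \<open>u\<^sup>r\<close> for \<open>r < 1\<close>, \<open>- u ln u\<close> for
  \<open>r = 1\<close> and \<open>- u\<^sup>r\<close> for \<open>r > 1\<close>. This function is concave, and the entropy of order \<open>r\<close> is an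
  increasing function of \<open>\<integral> \<phi>(f)\<close> (\<open>renyi_entropy_le_iff\<close>). Moreover \<open>\<phi>(u) = u \<psi>(u)\<close> with a
  decreasing \<open>\<psi>\<close>, and \<open>\<phi>' = r \<psi>\<close> up to a constant. The function \<open>\<psi>\<close> turns the \<open>s\<close>-mean into the
  arithmetic mean, so that \<open>f\<close> is \<open>s\<close>-concave exactly if \<open>\<psi>(f)\<close> is convex on the support of \<open>f\<close>
  (\<open>s_concave_iff\<close>). The theorem compares the first variation of the entropy, which is \<open>\<psi>(f)\<close> up to
  an affine change, with convexity.

  If \<open>\<psi>(f)\<close> is convex and \<open>Z = \<Sum> \<lambda>\<^sub>i X\<^sub>i\<close> has density \<open>w\<close>, integrate the tangent inequality
  \<open>\<phi>(w) \<le> \<phi>(f) + \<phi>'(f) (w - f)\<close>. Since both densities have mass one, the result is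
  \<open>\<integral> \<phi>(w) \<le> \<integral> \<phi>(f) + r (E \<psi>(f(Z)) - E \<psi>(f(X\<^sub>1)))\<close>, and the bracket is at most zero by Jensen's
  inequality (\<open>entropy_coupling_sum_le\<close>). Taking all \<open>X\<^sub>i\<close> equal attains the bound.

  For the converse only the weights \<open>1/2, 1/2, 0, \<dots>, 0\<close> are used. Starting from \<open>X\<^sub>1 = X\<^sub>2\<close>, recouple
  a little mass: with a symmetric density \<open>q\<close> on pairs, take the marginal of \<open>\<epsilon> q\<close> off the diagonal
  and let \<open>(X\<^sub>1, X\<^sub>2)\<close> have density \<open>\<epsilon> q\<close> instead. To first order this changes \<open>\<integral> \<phi>\<close> of the density
  of the mean by \<open>\<epsilon> r\<close> times the integral of \<open>\<psi>(f((x + y)/2)) - (\<psi>(f(x)) + \<psi>(f(y)))/2\<close> against \<open>q\<close>.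
  If the entropy of \<open>f\<close> is maximal, this bracket is therefore at most zero for almost all pairs of
  points of the support (\<open>uniform_violations_null\<close>): \<open>\<psi>(f)\<close> is midpoint convex almost everywhere.
  The recoupling argument needs \<open>\<integral> \<phi>(f) > -\<infinity>\<close>. This follows from maximality, because some coupling
  gives the mean a bounded density (\<open>bounded_midpoint_coupling\<close>).

  It remains to replace \<open>f\<close> by an \<open>s\<close>-concave function that is equal to \<open>f\<close> almost everywhere. A
  measurable set that contains the midpoints of almost all pairs of its points is an open convex set
  up to a null set (\<open>AE_midpoint_closed_imp_AE_eq_convex\<close>). Applied to the epigraph of \<open>\<psi>(f)\<close>, this
  gives an open convex set whose lower boundary is the convex function sought. For \<open>s < 0\<close> that
  function could vanish at a point, and \<open>f\<close> would have a pole there; this is where \<open>r > 1 - 1/d\<close>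
  enters, for such a pole would not be integrable (\<open>AE_midpoint_concave_imp_s_concave_density\<close>).
\<close>


section \<open>The functions that linearise concavity and entropy\<close>

text \<open>
  For positive arguments: the decreasing function that turns the \<open>s\<close>-mean into the arithmetic mean.
  The sign \<open>- sgn s\<close> makes it decreasing for \<open>s > 0\<close> as well, so that \<open>s\<close>-concavity becomes convexity
  of \<open>psi s \<circ> f\<close> whatever the sign of \<open>s\<close>.
\<close>
definition psi :: "real \<Rightarrow> real \<Rightarrow> real" where
  "psi s a = (if s = 0 then - ln a else - sgn s * a powr s)"

text \<open>
  The integrand of the entropy of order \<open>r\<close>: it is \<open>u powr r\<close> for \<open>r < 1\<close>, \<open>- u * ln u\<close> for \<open>r = 1\<close>
  and \<open>- (u powr r)\<close> for \<open>r > 1\<close>. Since its derivative is an affine function of \<open>psi (r - 1)\<close>, the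
  entropy of order \<open>r\<close> and \<open>(r - 1)\<close>-concavity belong together.
\<close>
definition phi :: "real \<Rightarrow> real \<Rightarrow> real" where
  "phi r u = u * psi (r - 1) u"

lemma borel_measurable_psi [measurable]: "psi s \<in> borel_measurable borel"
  unfolding psi_def by measurable

lemma borel_measurable_phi [measurable]: "phi r \<in> borel_measurable borel"
  unfolding phi_def by measurable

lemma phi_0 [simp]: "phi r 0 = 0"
  by (simp add: phi_def)

lemma psi_strict_antimono:
  assumes "0 < a" "a < b" shows "psi s b < psi s a"
proof -
  consider "s = 0" | "s > 0" | "s < 0" by linarith
  then show ?thesis
  proof cases
    case 2 then show ?thesis using assms by (simp add: psi_def powr_less_mono2)
  next
    case 3 then show ?thesis using assms by (simp add: psi_def powr_less_mono2_neg)
  qed (use assms in \<open>simp add: psi_def\<close>)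
qed

lemma psi_le_iff:
  assumes "0 < a" "0 < b" shows "psi s b \<le> psi s a \<longleftrightarrow> a \<le> b"
  using psi_strict_antimono[of a b s] psi_strict_antimono[of b a s] assms
  by (cases a b rule: linorder_cases) auto

lemma psi_antimono: "0 < a \<Longrightarrow> a \<le> b \<Longrightarrow> psi s b \<le> psi s a"
  by (subst psi_le_iff) auto

lemma weighted_mean_pos:
  assumes "0 < a" "0 < b" "0 < t" "t < 1" shows "0 < weighted_mean s t a b"
proof -
  have "0 < (1 - t) * a powr s + t * b powr s"
    using assms by (intro add_pos_pos mult_pos_pos) auto
  then show ?thesis using assms by (auto simp: weighted_mean_def)
qed

lemma psi_weighted_mean:
  assumes "0 < a" "0 < b" "0 < t" "t < 1"
  shows "psi s (weighted_mean s t a b) = (1 - t) * psi s a + t * psi s b"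
proof (cases "s = 0")
  case True
  then show ?thesis using assms by (simp add: psi_def weighted_mean_def ln_mult ln_powr)
next
  case False
  have "0 < (1 - t) * a powr s + t * b powr s"
    using assms by (intro add_pos_pos mult_pos_pos) auto
  then show ?thesis using False assms
    by (simp add: psi_def weighted_mean_def powr_powr algebra_simps)
qed

lemma weighted_mean_le_iff:
  assumes "0 < a" "0 < b" "0 < t" "t < 1" "0 \<le> c"
  shows "weighted_mean s t a b \<le> c \<longleftrightarrow> 0 < c \<and> psi s c \<le> (1 - t) * psi s a + t * psi s b"
proof (cases "c = 0")
  case False
  then show ?thesis using psi_le_iff[of "weighted_mean s t a b" c s] weighted_mean_pos[of a b t s] assms
    by (simp add: psi_weighted_mean)
qed (use weighted_mean_pos[of a b t s] assms in auto)

text \<open>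
  The weighted \<open>s\<close>-mean is the arithmetic mean in the scale of \<open>psi s\<close>, and \<open>psi s\<close> reverses
  inequalities. The positivity of the middle value has to be kept, because \<open>psi s 0\<close> is only a
  default value.
\<close>
lemma s_concave_iff:
  "s_concave s g \<longleftrightarrow> (\<forall>x. 0 \<le> g x) \<and>
     (\<forall>x y t. 0 < g x \<and> 0 < g y \<and> 0 < t \<and> t < 1 \<longrightarrow>
        0 < g ((1 - t) *\<^sub>R x + t *\<^sub>R y) \<and>
        psi s (g ((1 - t) *\<^sub>R x + t *\<^sub>R y)) \<le> (1 - t) * psi s (g x) + t * psi s (g y))"
  (is "_ = (?N \<and> ?C)")
proof (cases ?N)
  case True
  then have "0 < g x * g y \<longleftrightarrow> 0 < g x \<and> 0 < g y" for x y
    by (metis less_eq_real_def mult_pos_pos mult_zero_left mult_zero_right order_less_irrefl)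
  with True show ?thesis
    unfolding s_concave_def using weighted_mean_le_iff by auto
qed (auto simp: s_concave_def)

lemma s_concave_imp_convex:
  assumes "s_concave s g"
  shows "convex_on {x. 0 < g x} (\<lambda>x. psi s (g x))"
proof (rule convex_onI)
  show "convex {x. 0 < g x}"
    unfolding convex_alt
  proof safe
    fix x y and t :: real assume "0 < g x" "0 < g y" "0 \<le> t" "t \<le> 1"
    then show "0 < g ((1 - t) *\<^sub>R x + t *\<^sub>R y)"
      using assms[unfolded s_concave_iff] by (cases "t = 0 \<or> t = 1") auto
  qed
qed (use assms[unfolded s_concave_iff] in auto)

text \<open>
  The inverse of \<open>psi s\<close> on its range, which is a half-line if \<open>s \<noteq> 0\<close>. For \<open>s > 0\<close> the value \<open>0\<close>
  beyond the range \<open>w < 0\<close> is the one by which \<open>s\<close>-concave functions continue outside their support.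
\<close>
definition psi_inv :: "real \<Rightarrow> real \<Rightarrow> real" where
  "psi_inv s w = (if s = 0 then exp (- w) else (max 0 (- sgn s * w)) powr (1 / s))"

lemma psi_inv_nonneg [simp]: "0 \<le> psi_inv s w"
  by (simp add: psi_inv_def)

lemma psi_inv_psi:
  assumes "0 < a" shows "psi_inv s (psi s a) = a"
proof -
  consider "s = 0" | "s > 0" | "s < 0" by linarith
  then show ?thesis
    by cases (use assms in \<open>simp_all add: psi_inv_def psi_def powr_powr\<close>)
qed

lemma psi_psi_inv:
  assumes "0 < psi_inv s w" shows "psi s (psi_inv s w) = w"
proof -
  consider "s = 0" | "s > 0" | "s < 0" by linarith
  then show ?thesis
    by cases (use assms in \<open>simp_all add: psi_inv_def psi_def powr_powr split: if_splits\<close>)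
qed

lemma psi_inv_pos_iff: "0 < psi_inv s w \<longleftrightarrow> s = 0 \<or> sgn s * w < 0"
  by (cases "sgn s * w < 0") (auto simp: psi_inv_def max_def)

lemma has_derivative_phi:
  assumes "0 < u"
  shows "(phi r has_real_derivative (r * psi (r - 1) u - (if r = 1 then 1 else 0))) (at u)"
proof (cases "r = 1")
  case True
  have "((\<lambda>u. u * - ln u) has_real_derivative (- ln u - 1)) (at u)"
    using assms by (auto intro!: derivative_eq_intros)
  then show ?thesis using True by (simp add: phi_def[abs_def] psi_def)
next
  case False
  have D: "((\<lambda>u. u * (- sgn (r - 1) * u powr (r - 1))) has_real_derivative
      (1 * (- sgn (r - 1) * u powr (r - 1)) + (- sgn (r - 1) * ((r - 1) * u powr (r - 1 - 1))) * u)) (at u)"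
    using assms by (auto intro!: derivative_eq_intros)
  have u: "u powr (r - 1 - 1) * u = u powr (r - 1)"
    using assms by (metis powr_mult_base mult.commute less_imp_le add.commute diff_add_cancel)
  have "1 * (- sgn (r - 1) * u powr (r - 1)) + (- sgn (r - 1) * ((r - 1) * u powr (r - 1 - 1))) * u
      = (- sgn (r - 1)) * (u powr (r - 1) + (r - 1) * (u powr (r - 1 - 1) * u))"
    by (simp only: algebra_simps)
  also have "\<dots> = r * psi (r - 1) u - (if r = 1 then 1 else 0)"
    unfolding u using False by (simp add: psi_def algebra_simps)
  finally have "1 * (- sgn (r - 1) * u powr (r - 1)) + (- sgn (r - 1) * ((r - 1) * u powr (r - 1 - 1))) * u
      = r * psi (r - 1) u - (if r = 1 then 1 else 0)" .
  with D have "((\<lambda>u. u * (- sgn (r - 1) * u powr (r - 1))) has_real_derivative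
      r * psi (r - 1) u - (if r = 1 then 1 else 0)) (at u)"
    by (rule DERIV_cong)
  moreover have "phi r = (\<lambda>u. u * (- sgn (r - 1) * u powr (r - 1)))"
    using False by (auto simp: phi_def psi_def)
  ultimately show ?thesis by simp
qed

text \<open>
  The derivative of \<open>phi r\<close> decreases together with \<open>psi (r - 1)\<close>, so \<open>phi r\<close> is concave and lies
  below its tangents; the endpoint \<open>b = 0\<close> is included because a density may vanish.
\<close>
lemma phi_tangent:
  assumes "0 < r" "0 < a" "0 \<le> b"
  shows "phi r b \<le> phi r a + (r * psi (r - 1) a - (if r = 1 then 1 else 0)) * (b - a)"
proof (cases "b = 0")
  case True
  have "0 \<le> a * ((1 - r) * psi (r - 1) a + (if r = 1 then 1 else 0))"
    using assms by (intro mult_nonneg_nonneg)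
      (auto simp: psi_def sgn_if mult_le_0_iff)
  then show ?thesis using True by (auto simp: phi_def algebra_simps)
next
  case False
  have "convex_on {0<..} (\<lambda>u. - phi r u)"
  proof (rule convex_on_realI)
    show "((\<lambda>u. - phi r u) has_real_derivative - (r * psi (r - 1) u - (if r = 1 then 1 else 0))) (at u)"
      if "u \<in> {0<..}" for u using that by (intro DERIV_minus has_derivative_phi) auto
    show "- (r * psi (r - 1) x - (if r = 1 then 1 else 0)) \<le> - (r * psi (r - 1) y - (if r = 1 then 1 else 0))"
      if "x \<in> {0<..}" "y \<in> {0<..}" "x \<le> y" for x y
      using that assms psi_antimono[of x y "r - 1"] by (auto intro: mult_left_mono)
  qed auto
  then have "- phi r b - (- phi r a) \<ge> - (r * psi (r - 1) a - (if r = 1 then 1 else 0)) * (b - a)"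
  proof (rule convex_on_imp_above_tangent)
    show "((\<lambda>u. - phi r u) has_real_derivative - (r * psi (r - 1) a - (if r = 1 then 1 else 0))) (at a within {0<..})"
      by (rule has_field_derivative_at_within[OF DERIV_minus[OF has_derivative_phi[OF assms(2)]]])
    show "a \<in> interior {0<..}"
      using assms by (simp add: interior_open[OF open_greaterThan])
    show "connected {0::real<..}" by simp
    show "b \<in> {0<..}" using assms False by simp
  qed
  then show ?thesis by (simp add: algebra_simps)
qed

text \<open>
  Over a bounded region the right-hand side has a finite integral for every density, which keeps
  the positive part of the entropy integral finite there.
\<close>
lemma phi_le:
  assumes "0 < r" "0 \<le> u" shows "phi r u \<le> 1 + u"
proof (cases "u = 0 \<or> r > 1")
  case True
  then show ?thesis using assms
    by (cases "u = 0") (auto simp: phi_def psi_def intro: order_trans[of _ 0])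
next
  case False
  have "phi r u \<le> phi r 1 + (r * psi (r - 1) 1 - (if r = 1 then 1 else 0)) * (u - 1)"
    using assms by (intro phi_tangent) auto
  also have "\<dots> \<le> 1 + u"
  proof -
    have "r * u \<le> 1 * u" using False assms by (intro mult_right_mono) auto
    then have "1 + r * (u - 1) \<le> 1 + u" using assms by (simp add: right_diff_distrib)
    then show ?thesis using False assms
      by (cases "r = 1") (simp_all add: phi_def psi_def)
  qed
  finally show ?thesis .
qed

section \<open>Sets closed under almost all midpoints\<close>

lemma nn_integral_lborel_affine:
  fixes h :: "'a::euclidean_space \<Rightarrow> ennreal"
  assumes [measurable]: "h \<in> borel_measurable borel" and c: "c \<noteq> 0"
  shows "(\<integral>\<^sup>+x. h x \<partial>lborel) = ennreal (\<bar>c\<bar> ^ DIM('a)) * (\<integral>\<^sup>+x. h (t + c *\<^sub>R x) \<partial>lborel)"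
  by (subst lborel_affine[OF c, of t], subst nn_integral_density)
     (auto simp: nn_integral_distr nn_integral_cmult)

lemma AE_lborel_affine:
  fixes P :: "'a::euclidean_space \<Rightarrow> bool"
  assumes P: "AE x in lborel. P x" and c: "c \<noteq> 0"
  shows "AE x in lborel. P (t + c *\<^sub>R x)"
proof -
  obtain N where N: "N \<in> null_sets lborel" "{x. \<not> P x} \<subseteq> N"
    using P by (rule AE_E3) (force simp: null_sets_def)
  then have [measurable]: "N \<in> sets borel" by (auto simp: null_sets_def)
  have "ennreal (\<bar>c\<bar> ^ DIM('a)) * (\<integral>\<^sup>+x. indicator N (t + c *\<^sub>R x) \<partial>lborel) = (\<integral>\<^sup>+x. indicator N x \<partial>lborel)"
    by (rule nn_integral_lborel_affine[of "indicator N" c t, symmetric]) (use c in auto)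
  also have "\<dots> = 0" using N by (auto simp: null_sets_def)
  finally have "(\<integral>\<^sup>+x. indicator N (t + c *\<^sub>R x) \<partial>lborel) = 0"
    using c by simp
  then have "AE x in lborel. indicator N (t + c *\<^sub>R x) = (0::ennreal)"
    by (subst nn_integral_0_iff_AE[symmetric]) auto
  then show ?thesis by eventually_elim (use N in \<open>auto simp: indicator_def split: if_splits\<close>)
qed

lemma emeasure_lborel_affine_image:
  fixes A :: "'a::euclidean_space set"
  assumes [measurable]: "A \<in> sets borel" and c: "c \<noteq> 0"
  shows "emeasure lborel ((\<lambda>x. t + c *\<^sub>R x) -` A) = ennreal ((1 / \<bar>c\<bar>) ^ DIM('a)) * emeasure lborel A"
proof -
  have [measurable]: "(\<lambda>x. t + c *\<^sub>R x) -` A \<in> sets borel"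
    using measurable_sets[of "\<lambda>x. t + c *\<^sub>R x" borel borel A] by simp
  have "emeasure lborel A = (\<integral>\<^sup>+x. indicator A x \<partial>lborel)" by simp
  also have "\<dots> = ennreal (\<bar>c\<bar> ^ DIM('a)) * (\<integral>\<^sup>+x. indicator A (t + c *\<^sub>R x) \<partial>lborel)"
    by (rule nn_integral_lborel_affine[of "indicator A" c t]) (use c in auto)
  also have "(\<integral>\<^sup>+x. indicator A (t + c *\<^sub>R x) \<partial>lborel) = (\<integral>\<^sup>+x. indicator ((\<lambda>x. t + c *\<^sub>R x) -` A) x \<partial>lborel)"
    by (simp add: indicator_def)
  also have "\<dots> = emeasure lborel ((\<lambda>x. t + c *\<^sub>R x) -` A)"
    by (rule nn_integral_indicator) simp
  finally have "emeasure lborel A = ennreal (\<bar>c\<bar> ^ DIM('a)) * emeasure lborel ((\<lambda>x. t + c *\<^sub>R x) -` A)" .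
  moreover have "ennreal ((1 / \<bar>c\<bar>) ^ DIM('a)) * ennreal (\<bar>c\<bar> ^ DIM('a)) = 1"
    using c by (simp add: ennreal_mult[symmetric] power_mult_distrib[symmetric])
  ultimately show ?thesis by (metis mult.assoc mult_1)
qed

lemma open_positive_measure:
  fixes U :: "'a::euclidean_space set"
  assumes "open U" "x \<in> U" shows "0 < emeasure lborel U"
proof -
  have "\<not> negligible U" using assms open_not_negligible by blast
  then show ?thesis using assms(1)
    by (auto simp: negligible_iff_null_sets null_sets_completion_iff null_sets_def zero_less_iff_neq_zero)
qed

lemma AE_open_nonempty:
  fixes U :: "'a::euclidean_space set"
  assumes "AE x in lborel. P x" "open U" "U \<noteq> {}"
  obtains x where "x \<in> U" "P x"
proof -
  have "\<not> (AE x in lborel. x \<notin> U)"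
    using open_positive_measure[OF assms(2)] assms(2,3) AE_iff_measurable[of U lborel "\<lambda>x. x \<notin> U"] by auto
  with assms(1) that show ?thesis
    by (metis (mono_tags, lifting) eventually_mono)
qed


text \<open>
  By Lindelof's theorem countably many of the given balls cover \<open>U\<close>.
\<close>
lemma AE_lborel_locally:
  fixes U :: "'a::euclidean_space set"
  assumes "\<And>x. x \<in> U \<Longrightarrow> \<exists>\<delta>>0. AE z in lborel. z \<in> ball x \<delta> \<longrightarrow> P z"
  shows "AE z in lborel. z \<in> U \<longrightarrow> P z"
proof -
  define F where "F = {ball x \<delta> | x \<delta>. 0 < \<delta> \<and> (AE z in lborel. z \<in> ball x \<delta> \<longrightarrow> P z)}"
  obtain F' where F': "F' \<subseteq> F" "countable F'" "\<Union>F' = \<Union>F"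
    by (rule Lindelof[of F]) (auto simp: F_def)
  have "AE z in lborel. \<forall>B\<in>F'. z \<in> B \<longrightarrow> P z"
    using F' by (subst AE_ball_countable) (auto simp: F_def)
  moreover have U: "U \<subseteq> \<Union>F'"
  proof
    fix x assume "x \<in> U"
    then obtain \<delta> where "\<delta> > 0" "AE z in lborel. z \<in> ball x \<delta> \<longrightarrow> P z" using assms by blast
    then have "ball x \<delta> \<in> F" "x \<in> ball x \<delta>" by (auto simp: F_def)
    then show "x \<in> \<Union>F'" unfolding F'(3) by blast
  qed
  ultimately show ?thesis by (auto elim!: eventually_mono)
qed

text \<open>
  Dyadic points alone would not suffice, since \<open>U\<close> is not closed. Instead, fix a radius \<open>e\<close> that fits
  at both endpoints of a segment and consider the parameters at which a ball of that radius lies in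
  \<open>U\<close>. They form a set that is closed under midpoints and closed as well, and so has no gap.
\<close>
lemma midpoint_convex_imp_convex:
  fixes U :: "'a::real_normed_vector set"
  assumes "open U" and mid: "\<And>x y. x \<in> U \<Longrightarrow> y \<in> U \<Longrightarrow> midpoint x y \<in> U"
  shows "convex U"
  unfolding convex_alt
proof (intro ballI allI impI)
  fix x y and u :: real assume xy: "x \<in> U" "y \<in> U" and u: "0 \<le> u \<and> u \<le> 1"
  define w where "w t = x + t *\<^sub>R (y - x)" for t
  obtain e1 e2 where e: "e1 > 0" "ball x e1 \<subseteq> U" "e2 > 0" "ball y e2 \<subseteq> U"
    using xy \<open>open U\<close> by (meson open_contains_ball)
  define e where "e = min e1 e2"
  have "e > 0" using e by (simp add: e_def)
  define T where "T = {t \<in> {0..1}. ball (w t) e \<subseteq> U}"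
  have "closed T"
    unfolding closed_sequential_limits
  proof (intro allI impI)
    fix t l assume *: "(\<forall>n. t n \<in> T) \<and> t \<longlonglongrightarrow> l"
    then have "l \<in> {0..1}"
      by (intro closed_sequentially[of "{0..1}" t l]) (auto simp: T_def)
    moreover have "z \<in> U" if "z \<in> ball (w l) e" for z
    proof -
      have "(\<lambda>n. dist (w (t n)) z) \<longlonglongrightarrow> dist (w l) z"
        unfolding w_def using * by (intro tendsto_intros) auto
      moreover have "dist (w l) z < e" using that by simp
      ultimately have "eventually (\<lambda>n. dist (w (t n)) z < e) sequentially"
        by (rule order_tendstoD(2))
      then obtain n where "dist (w (t n)) z < e" by (auto simp: eventually_sequentially)
      then show ?thesis using * by (auto simp: T_def subset_iff)
    qed
    ultimately show "l \<in> T" by (auto simp: T_def)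
  qed
  have T01: "0 \<in> T" "1 \<in> T" using e by (auto simp: T_def w_def e_def)
  have Tmid: "(s + t) / 2 \<in> T" if "s \<in> T" "t \<in> T" for s t
  proof -
    have "z \<in> U" if z: "z \<in> ball (w ((s + t) / 2)) e" for z
    proof -
      define h where "h = z - w ((s + t) / 2)"
      have "norm h < e" using z by (simp add: h_def dist_norm norm_minus_commute)
      then have "w s + h \<in> U" "w t + h \<in> U"
        using \<open>s \<in> T\<close> \<open>t \<in> T\<close> unfolding T_def by (auto simp: dist_norm subset_iff)
      then have "midpoint (w s + h) (w t + h) \<in> U" by (rule mid)
      also have "midpoint (w s + h) (w t + h) = z"
      proof -
        have "w s + w t = 2 *\<^sub>R w ((s + t) / 2)"
          by (simp add: w_def scaleR_add_right scaleR_2 flip: scaleR_add_left)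
        moreover have "w s + h + (w t + h) = (w s + w t) + 2 *\<^sub>R h" by (simp add: scaleR_2)
        ultimately have "w s + h + (w t + h) = 2 *\<^sub>R z"
          by (simp add: h_def scaleR_diff_right)
        then show ?thesis by (simp add: midpoint_def)
      qed
      finally show ?thesis .
    qed
    then show ?thesis using that by (auto simp: T_def)
  qed
  have "u \<in> T"
  proof (rule ccontr)
    assume "u \<notin> T"
    define A where "A = T \<inter> {..u}" define B where "B = T \<inter> {u..}"
    have A: "closed A" "bdd_above A" "A \<noteq> {}" and B: "closed B" "bdd_below B" "B \<noteq> {}"
      using \<open>closed T\<close> T01 u unfolding A_def B_def by (auto intro!: closed_Int)
    have a: "Sup A \<in> A" and b: "Inf B \<in> B"
      using A B by (auto intro: closed_contains_Sup closed_contains_Inf)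
    have "Sup A < u" "u < Inf B" using a b \<open>u \<notin> T\<close> unfolding A_def B_def by (auto simp: less_le)
    have m: "(Sup A + Inf B) / 2 \<in> T" using a b Tmid by (auto simp: A_def B_def)
    show False
    proof (cases "(Sup A + Inf B) / 2 \<le> u")
      case True
      then have "(Sup A + Inf B) / 2 \<le> Sup A" using m A by (intro cSup_upper) (auto simp: A_def)
      with \<open>Sup A < u\<close> \<open>u < Inf B\<close> show False by simp
    next
      case False
      then have "Inf B \<le> (Sup A + Inf B) / 2" using m B by (intro cInf_lower) (auto simp: B_def)
      with \<open>Sup A < u\<close> \<open>u < Inf B\<close> show False by simp
    qed
  qed
  then show "(1 - u) *\<^sub>R x + u *\<^sub>R y \<in> U"
    using \<open>e > 0\<close> by (auto simp: T_def w_def subset_iff algebra_simps)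
qed

text \<open>
  The coordinates \<open>(x, z)\<close> with \<open>z = midpoint x y\<close> describe the same null sets as \<open>(x, y)\<close>, since
  \<open>y \<mapsto> midpoint x y\<close> is affine and invertible for each \<open>x\<close>; exchanging the quantifiers is Fubini's
  theorem.
\<close>
lemma AE_pair_reflect:
  fixes P :: "'a::euclidean_space \<Rightarrow> 'a \<Rightarrow> bool"
  assumes P: "{p. P (fst p) (snd p)} \<in> sets borel"
  shows "(AE x in lborel. AE y in lborel. P x y) \<longleftrightarrow> (AE z in lborel. AE x in lborel. P x (2 *\<^sub>R z - x))"
proof -
  have "(AE y in lborel. P x y) \<longleftrightarrow> (AE z in lborel. P x (2 *\<^sub>R z - x))" for x
  proof
    assume "AE y in lborel. P x y"
    from AE_lborel_affine[OF this, of 2 "-x"] show "AE z in lborel. P x (2 *\<^sub>R z - x)"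
      by simp
  next
    assume "AE z in lborel. P x (2 *\<^sub>R z - x)"
    from AE_lborel_affine[OF this, of "1/2" "(1/2) *\<^sub>R x"] show "AE y in lborel. P x y"
      by (simp add: scaleR_add_right)
  qed
  moreover have "{p. P (fst p) (2 *\<^sub>R snd p - fst p)} \<in> sets borel"
  proof -
    have "(\<lambda>p::'a \<times> 'a. (fst p, 2 *\<^sub>R snd p - fst p)) \<in> borel_measurable borel"
      by (intro borel_measurable_continuous_onI continuous_intros)
    from measurable_sets[OF this P] show ?thesis by (simp add: vimage_def)
  qed
  ultimately show ?thesis
    by (simp, subst lborel_pair.AE_commute) (simp_all add: space_pair_measure flip: borel_prod)
qed


text \<open>
  Choose an open \<open>W \<supseteq> K\<close> with \<open>W - K\<close> of smaller measure than \<open>K\<close>. A translate of \<open>K\<close> that stays in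
  \<open>W\<close> does not fit into \<open>W - K\<close>.
\<close>
lemma compact_translate_overlap:
  fixes K :: "'a::euclidean_space set"
  assumes K: "compact K" "0 < emeasure lborel K"
  obtains \<rho> where "0 < \<rho>" "\<And>h. norm h < \<rho> \<Longrightarrow> 0 < emeasure lborel (K \<inter> (\<lambda>x. x - h) -` K)"
proof -
  have [measurable]: "K \<in> sets borel" using K by (auto intro: borel_compact)
  have fin: "emeasure lborel K < \<infinity>"
    using K by (intro emeasure_bounded_finite compact_imp_bounded)
  then obtain m where m: "emeasure lborel K = ennreal m" "m > 0"
    using K by (cases "emeasure lborel K") auto
  obtain W where W: "open W" "K \<subseteq> W" "emeasure lborel (W - K) < ennreal m"
    using outer_regular_lborel[of K m] m by auto
  then have [measurable]: "W \<in> sets borel" by auto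
  obtain \<rho> where \<rho>: "\<rho> > 0" "(\<Union>x\<in>K. ball x \<rho>) \<subseteq> W"
    using compact_subset_open_imp_ball_epsilon_subset[of K W] K W by auto
  show thesis
  proof
    fix h :: 'a assume h: "norm h < \<rho>"
    let ?Kh = "(\<lambda>x. x - h) -` K"
    have eq: "?Kh = (\<lambda>x. - h + 1 *\<^sub>R x) -` K" by auto
    have [measurable]: "?Kh \<in> sets borel"
      using measurable_sets[of "\<lambda>x. x - h" borel borel K] by simp
    have "emeasure lborel K = emeasure lborel ?Kh"
      unfolding eq by (subst emeasure_lborel_affine_image) auto
    also have "?Kh \<subseteq> (W - K) \<union> (K \<inter> ?Kh)"
    proof
      fix x assume x: "x \<in> ?Kh"
      have "x \<in> ball (x - h) \<rho>" using h by (simp add: dist_norm)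
      then have "x \<in> W" using \<rho>(2) x by blast
      then show "x \<in> (W - K) \<union> (K \<inter> ?Kh)" using x by blast
    qed
    then have "emeasure lborel ?Kh \<le> emeasure lborel ((W - K) \<union> (K \<inter> ?Kh))"
      by (intro emeasure_mono) auto
    also have "\<dots> \<le> emeasure lborel (W - K) + emeasure lborel (K \<inter> ?Kh)"
      by (intro emeasure_subadditive) auto
    finally show "0 < emeasure lborel (K \<inter> ?Kh)"
      using W(3) m by (auto simp: zero_less_iff_neq_zero)
  qed (rule \<rho>)
qed

text \<open>
  A form of Steinhaus's theorem. As \<open>A \<times> A\<close> is not a null set, \<open>A\<close> overlaps its reflection in some
  point \<open>z\<^sub>0\<close>. The overlap \<open>L\<close> is symmetric about \<open>z\<^sub>0\<close>, so reflecting it in a nearby point \<open>z\<close> amounts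
  to translating it by \<open>2 (z - z\<^sub>0)\<close>, and short translates of a compact part of \<open>L\<close> overlap.
\<close>
lemma reflection_overlap_open:
  fixes A :: "'a::euclidean_space set"
  assumes [measurable]: "A \<in> sets borel" and A: "0 < emeasure lborel A"
  obtains z\<^sub>0 \<rho> where "0 < \<rho>"
    "\<And>z. z \<in> ball z\<^sub>0 \<rho> \<Longrightarrow> 0 < emeasure lborel (A \<inter> (\<lambda>x. 2 *\<^sub>R z - x) -` A)"
proof -
  have [measurable]: "(\<lambda>x. 2 *\<^sub>R z - x) -` B \<in> sets borel" if "B \<in> sets borel" for z :: 'a and B
    using measurable_sets[of "\<lambda>x. 2 *\<^sub>R z - x" borel borel B] that by simp
  have "\<exists>n. 0 < emeasure lborel (A \<inter> ball 0 (real n))"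
  proof (rule ccontr)
    assume "\<not> ?thesis"
    then have "A \<inter> ball 0 (real n) \<in> null_sets lborel" for n
      by (auto simp: null_sets_def zero_less_iff_neq_zero)
    then have "(\<Union>n. A \<inter> ball 0 (real n)) \<in> null_sets lborel" by blast
    also have "(\<Union>n. A \<inter> ball 0 (real n)) = A"
      using reals_Archimedean2 by (auto simp: dist_norm)
    finally show False using A by auto
  qed
  then obtain n where n: "0 < emeasure lborel (A \<inter> ball 0 (real n))" ..
  define B where "B = A \<inter> ball 0 (real n)"
  have B[measurable]: "B \<in> sets borel" and "B \<subseteq> A" "bounded B" by (auto simp: B_def bounded_Int)
  have "\<exists>z. 0 < emeasure lborel (B \<inter> (\<lambda>x. 2 *\<^sub>R z - x) -` B)"
  proof (rule ccontr)
    assume *: "\<not> ?thesis"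
    have "AE z in lborel. AE x in lborel. \<not> (x \<in> B \<and> 2 *\<^sub>R z - x \<in> B)"
    proof (rule AE_I2)
      fix z :: 'a
      have "B \<inter> (\<lambda>x. 2 *\<^sub>R z - x) -` B \<in> null_sets lborel"
        using * by (auto simp: null_sets_def zero_less_iff_neq_zero)
      from AE_not_in[OF this] show "AE x in lborel. \<not> (x \<in> B \<and> 2 *\<^sub>R z - x \<in> B)" by auto
    qed
    moreover have "{p. \<not> (fst p \<in> B \<and> snd p \<in> B)} \<in> sets borel"
    proof -
      have "{p \<in> space (borel \<Otimes>\<^sub>M borel). \<not> (fst p \<in> B \<and> snd p \<in> B)} \<in> sets (borel \<Otimes>\<^sub>M borel)"
        by measurable
      then show ?thesis by (simp add: space_pair_measure flip: borel_prod)
    qed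
    ultimately have "AE x in lborel. AE y in lborel. \<not> (x \<in> B \<and> y \<in> B)"
      by (subst AE_pair_reflect)
    moreover have "\<not> (AE x in lborel. x \<notin> B)"
      using n B by (subst AE_iff_measurable[of B]) (auto simp: B_def)
    ultimately show False
      by (metis (mono_tags, lifting) eventually_mono)
  qed
  then obtain z\<^sub>0 where z0: "0 < emeasure lborel (B \<inter> (\<lambda>x. 2 *\<^sub>R z\<^sub>0 - x) -` B)" ..
  define L where "L = B \<inter> (\<lambda>x. 2 *\<^sub>R z\<^sub>0 - x) -` B"
  have [measurable]: "L \<in> sets borel" and "bounded L" "L \<subseteq> A" and sym: "\<And>x. x \<in> L \<Longrightarrow> 2 *\<^sub>R z\<^sub>0 - x \<in> L"
    using \<open>bounded B\<close> \<open>B \<subseteq> A\<close> by (auto simp: L_def bounded_Int)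
  have "emeasure lborel L < \<infinity>" using \<open>bounded L\<close> by (rule emeasure_bounded_finite)
  then obtain m where m: "emeasure lborel L = ennreal m" "m > 0"
    using z0 by (cases "emeasure lborel L") (auto simp: L_def)
  obtain K where K: "closed K" "K \<subseteq> L" "emeasure lebesgue (L - K) < ennreal m"
  proof (rule sets_lebesgue_inner_closed)
    show "L \<in> sets lebesgue" by simp
    show "0 < m" by fact
  qed
  have [measurable]: "K \<in> sets borel" using K by auto
  have "compact K" using K \<open>bounded L\<close> by (meson bounded_subset compact_eq_bounded_closed)
  moreover have "0 < emeasure lborel K"
  proof -
    have "emeasure lborel L \<le> emeasure lborel (L - K) + emeasure lborel K"
      using emeasure_subadditive[of "L - K" lborel K] K(2) by (simp add: Un_absorb2)
    then show ?thesis using K(3) m by (auto simp: zero_less_iff_neq_zero)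
  qed
  ultimately obtain \<rho> where \<rho>: "0 < \<rho>"
      "\<And>h. norm h < \<rho> \<Longrightarrow> 0 < emeasure lborel (K \<inter> (\<lambda>x. x - h) -` K)"
    using compact_translate_overlap by blast
  show thesis
  proof
    show "0 < \<rho> / 2" using \<rho> by simp
    fix z assume z: "z \<in> ball z\<^sub>0 (\<rho> / 2)"
    define h where "h = 2 *\<^sub>R (z - z\<^sub>0)"
    have "norm h < \<rho>" using z by (simp add: h_def dist_norm norm_minus_commute)
    then have "0 < emeasure lborel (K \<inter> (\<lambda>x. x - h) -` K)" by (rule \<rho>)
    also have "\<dots> \<le> emeasure lborel (A \<inter> (\<lambda>x. 2 *\<^sub>R z - x) -` A)"
    proof (intro emeasure_mono)
      show "K \<inter> (\<lambda>x. x - h) -` K \<subseteq> A \<inter> (\<lambda>x. 2 *\<^sub>R z - x) -` A"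
      proof
        fix x assume x: "x \<in> K \<inter> (\<lambda>x. x - h) -` K"
        then have "2 *\<^sub>R z\<^sub>0 - (x - h) \<in> L" using K(2) by (intro sym) auto
        moreover have "2 *\<^sub>R z\<^sub>0 - (x - h) = 2 *\<^sub>R z - x" by (simp add: h_def scaleR_diff_right)
        ultimately show "x \<in> A \<inter> (\<lambda>x. 2 *\<^sub>R z - x) -` A" using x K(2) \<open>L \<subseteq> A\<close> by auto
      qed
    qed auto
    finally show "0 < emeasure lborel (A \<inter> (\<lambda>x. 2 *\<^sub>R z - x) -` A)" .
  qed
qed

text \<open>
  Let \<open>U\<close> consist of the points near which \<open>E\<close> has full measure. If every ball around \<open>a\<close> meets \<open>E\<close>
  in positive measure and \<open>q \<in> U\<close>, then a point \<open>z\<close> near \<open>midpoint a q\<close> is the midpoint of many pairs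
  in \<open>E\<close>, since reflection in \<open>z\<close> maps a small ball around \<open>a\<close> into one around \<open>q\<close> that \<open>E\<close> fills;
  hence \<open>midpoint a q \<in> U\<close>. It follows that \<open>U\<close> is convex, and that \<open>a\<close> is the limit of the points
  \<open>a + (1/2)^k (q - a)\<close> of \<open>U\<close>. So \<open>E\<close> exceeds \<open>U\<close> only by points of the frontier of a convex set
  and a null set.
\<close>
theorem AE_midpoint_closed_imp_AE_eq_convex:
  fixes E :: "'a::euclidean_space set"
  assumes E[measurable]: "E \<in> sets borel"
    and mid: "AE x in lborel. AE y in lborel. x \<in> E \<and> y \<in> E \<longrightarrow> midpoint x y \<in> E"
  obtains U where "open U" "convex U" "AE x in lborel. x \<in> E \<longleftrightarrow> x \<in> U"
proof (cases "emeasure lborel E = 0")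
  case True
  then have "AE x in lborel. x \<notin> E" by (intro AE_not_in) (auto simp: null_sets_def)
  then show thesis by (intro that[of "{}"]) auto
next
  case False
  have [measurable]: "(\<lambda>x. 2 *\<^sub>R z - x) -` B \<in> sets borel" if "B \<in> sets borel" for z :: 'a and B
    using measurable_sets[of "\<lambda>x. 2 *\<^sub>R z - x" borel borel B] that by simp
  have R: "AE z in lborel. AE x in lborel. x \<in> E \<and> 2 *\<^sub>R z - x \<in> E \<longrightarrow> z \<in> E"
  proof -
    have "{p \<in> space (borel \<Otimes>\<^sub>M borel). fst p \<in> E \<and> snd p \<in> E \<longrightarrow> midpoint (fst p) (snd p) \<in> E}
        \<in> sets (borel \<Otimes>\<^sub>M borel)"
      unfolding midpoint_def by measurable
    then have "{p. fst p \<in> E \<and> snd p \<in> E \<longrightarrow> midpoint (fst p) (snd p) \<in> E} \<in> sets borel"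
      by (simp add: space_pair_measure flip: borel_prod)
    from AE_pair_reflect[OF this] mid show ?thesis
      by (simp add: midpoint_def)
  qed
  define full where "full p \<rho> \<longleftrightarrow> (AE z in lborel. z \<in> ball p \<rho> \<longrightarrow> z \<in> E)" for p \<rho>
  have full_mono: "full q \<sigma>" if "full p \<rho>" "ball q \<sigma> \<subseteq> ball p \<rho>" for p q \<rho> \<sigma>
    using that unfolding full_def by (auto elim!: eventually_mono)
  have fullI: "full p \<rho>"
    if *: "\<And>z. z \<in> ball p \<rho> \<Longrightarrow> 0 < emeasure lborel (E \<inter> (\<lambda>x. 2 *\<^sub>R z - x) -` E)" for p \<rho>
    unfolding full_def using R
  proof eventually_elim
    case (elim z)
    show ?case
    proof (rule impI, rule ccontr)
      assume z: "z \<in> ball p \<rho>" "z \<notin> E"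
      with elim have "AE x in lborel. x \<notin> E \<inter> (\<lambda>x. 2 *\<^sub>R z - x) -` E" by simp
      then have "emeasure lborel (E \<inter> (\<lambda>x. 2 *\<^sub>R z - x) -` E) = 0"
        by (subst (asm) AE_iff_measurable[of "E \<inter> (\<lambda>x. 2 *\<^sub>R z - x) -` E"]) auto
      with *[OF z(1)] show False by simp
    qed
  qed
  define supp where "supp = {a. \<forall>\<delta>>0. 0 < emeasure lborel (E \<inter> ball a \<delta>)}"
  define U where "U = {p. \<exists>\<rho>>0. full p \<rho>}"
  have openU: "open U"
    unfolding open_contains_ball
  proof
    fix p assume "p \<in> U"
    then obtain \<rho> where \<rho>: "\<rho> > 0" "full p \<rho>" by (auto simp: U_def)
    have "ball p \<rho> \<subseteq> U"
    proof
      fix q assume q: "q \<in> ball p \<rho>"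
      have "full q (\<rho> - dist p q)"
        using \<rho>(2)
        by (rule full_mono) (auto simp: subset_iff intro: le_less_trans[OF dist_triangle[of _ _ q]])
      then show "q \<in> U" using q by (auto simp: U_def intro!: exI[of _ "\<rho> - dist p q"])
    qed
    then show "\<exists>e>0. ball p e \<subseteq> U" using \<rho>(1) by blast
  qed
  have mid_supp: "midpoint a q \<in> U" if "a \<in> supp" "q \<in> U" for a q
  proof -
    obtain \<rho> where \<rho>: "\<rho> > 0" "full q \<rho>" using \<open>q \<in> U\<close> by (auto simp: U_def)
    have "full (midpoint a q) (\<rho> / 4)"
    proof (rule fullI)
      fix z assume z: "z \<in> ball (midpoint a q) (\<rho> / 4)"
      have "dist q (2 *\<^sub>R z - a) = 2 * dist (midpoint a q) z"
      proof -
        have "q - (2 *\<^sub>R z - a) = 2 *\<^sub>R (midpoint a q - z)"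
          by (simp add: midpoint_def scaleR_diff_right)
        then show ?thesis by (simp add: dist_norm)
      qed
      then have z': "dist q (2 *\<^sub>R z - a) < \<rho> / 2" using z by simp
      have "AE x in lborel. 2 *\<^sub>R z - x \<in> ball q \<rho> \<longrightarrow> 2 *\<^sub>R z - x \<in> E"
        using AE_lborel_affine[OF \<rho>(2)[unfolded full_def], of "-1" "2 *\<^sub>R z"] by simp
      then have "AE x in lborel. x \<in> E \<inter> ball a (\<rho> / 2) \<longrightarrow> x \<in> E \<inter> (\<lambda>x. 2 *\<^sub>R z - x) -` E"
      proof eventually_elim
        case (elim x)
        show ?case
        proof
          assume x: "x \<in> E \<inter> ball a (\<rho> / 2)"
          have "dist q (2 *\<^sub>R z - x) \<le> dist q (2 *\<^sub>R z - a) + dist (2 *\<^sub>R z - a) (2 *\<^sub>R z - x)"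
            by (rule dist_triangle)
          also have "dist (2 *\<^sub>R z - a) (2 *\<^sub>R z - x) = dist a x"
            by (simp add: dist_norm norm_minus_commute)
          finally have "2 *\<^sub>R z - x \<in> ball q \<rho>" using z' x by simp
          with elim x show "x \<in> E \<inter> (\<lambda>x. 2 *\<^sub>R z - x) -` E" by simp
        qed
      qed
      then have "emeasure lborel (E \<inter> ball a (\<rho> / 2)) \<le> emeasure lborel (E \<inter> (\<lambda>x. 2 *\<^sub>R z - x) -` E)"
        by (rule emeasure_mono_AE) auto
      moreover have "0 < emeasure lborel (E \<inter> ball a (\<rho> / 2))"
        using \<open>a \<in> supp\<close> \<rho>(1) by (auto simp: supp_def)
      ultimately show "0 < emeasure lborel (E \<inter> (\<lambda>x. 2 *\<^sub>R z - x) -` E)" by simp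
    qed
    then show ?thesis using \<rho>(1) by (auto simp: U_def intro!: exI[of _ "\<rho> / 4"])
  qed
  have "U \<subseteq> supp"
  proof
    fix p assume "p \<in> U"
    then obtain \<rho> where \<rho>: "\<rho> > 0" "full p \<rho>" by (auto simp: U_def)
    have "0 < emeasure lborel (E \<inter> ball p \<delta>)" if "\<delta> > 0" for \<delta>
    proof -
      have "0 < emeasure lborel (ball p (min \<delta> \<rho>))"
        using that \<rho> by (intro open_positive_measure[of _ p]) auto
      also have "\<dots> \<le> emeasure lborel (E \<inter> ball p \<delta>)"
        using \<rho>(2) unfolding full_def by (intro emeasure_mono_AE) (auto elim!: eventually_mono)
      finally show ?thesis .
    qed
    then show "p \<in> supp" by (simp add: supp_def)
  qed
  then have convexU: "convex U"
    using mid_supp by (intro midpoint_convex_imp_convex[OF openU]) auto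
  have "U \<noteq> {}"
  proof -
    obtain z\<^sub>0 \<rho> where "0 < \<rho>" "\<And>z. z \<in> ball z\<^sub>0 \<rho> \<Longrightarrow> 0 < emeasure lborel (E \<inter> (\<lambda>x. 2 *\<^sub>R z - x) -` E)"
    proof -
      have "0 < emeasure lborel E" using False by (simp add: zero_less_iff_neq_zero)
      from reflection_overlap_open[OF E this] that show thesis by blast
    qed
    then have "full z\<^sub>0 \<rho>" by (intro fullI)
    with \<open>0 < \<rho>\<close> show ?thesis by (auto simp: U_def)
  qed
  then obtain q where "q \<in> U" by blast
  have "supp \<subseteq> closure U"
  proof
    fix a assume a: "a \<in> supp"
    have "a + (1/2)^k *\<^sub>R (q - a) \<in> U" for k
    proof (induction k)
      case (Suc k)
      have "midpoint a (a + (1/2)^k *\<^sub>R (q - a)) = a + (1/2)^Suc k *\<^sub>R (q - a)"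
        by (simp add: midpoint_eq_iff scaleR_2[symmetric] scaleR_add_right)
      then show ?case using mid_supp[OF a Suc] by simp
    qed (use \<open>q \<in> U\<close> in simp)
    moreover have "(\<lambda>k. a + (1/2)^k *\<^sub>R (q - a)) \<longlonglongrightarrow> a + 0 *\<^sub>R (q - a)"
      by (intro tendsto_intros LIMSEQ_power_zero) auto
    ultimately show "a \<in> closure U"
      unfolding closure_sequential by (intro exI[of _ "\<lambda>k. a + (1/2)^k *\<^sub>R (q - a)"]) simp
  qed
  have "AE x in lborel. x \<in> - supp \<longrightarrow> x \<notin> E"
  proof (rule AE_lborel_locally)
    fix x assume "x \<in> - supp"
    then obtain \<delta> where \<delta>: "\<delta> > 0" "emeasure lborel (E \<inter> ball x \<delta>) = 0"
      by (auto simp: supp_def zero_less_iff_neq_zero)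
    then have "AE z in lborel. z \<notin> E \<inter> ball x \<delta>" by (intro AE_not_in) (auto simp: null_sets_def)
    then show "\<exists>\<delta>>0. AE z in lborel. z \<in> ball x \<delta> \<longrightarrow> z \<notin> E" using \<delta>(1) by (auto elim!: eventually_mono)
  qed
  moreover have "AE x in lborel. x \<in> U \<longrightarrow> x \<in> E"
    by (rule AE_lborel_locally) (auto simp: U_def full_def)
  moreover have "AE x in lborel. x \<notin> frontier U"
  proof (rule AE_not_in)
    have "negligible (frontier U)" by (rule negligible_convex_frontier[OF convexU])
    then show "frontier U \<in> null_sets lborel"
      by (simp add: negligible_iff_null_sets null_sets_completion_iff)
  qed
  ultimately have "AE x in lborel. x \<in> E \<longleftrightarrow> x \<in> U"
    by eventually_elim (use \<open>supp \<subseteq> closure U\<close> openU in \<open>auto simp: frontier_def interior_open\<close>)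
  with openU convexU show thesis by (rule that)
qed

section \<open>Functions midpoint concave almost everywhere\<close>

lemma AE_lborel_fst:
  assumes "AE x in lborel. Q x"
  shows "AE p in (lborel :: ('a::euclidean_space \<times> 'b::euclidean_space) measure). Q (fst p)"
proof -
  obtain N where N: "\<And>x. x \<notin> N \<Longrightarrow> Q x" "N \<in> null_sets lborel"
    using assms by (rule AE_E3) auto
  then have [measurable]: "N \<in> sets borel" by auto
  have "AE p in lborel \<Otimes>\<^sub>M (lborel :: 'b measure). fst p \<notin> N"
  proof (rule lborel_pair.AE_pair_measure)
    show "{p \<in> space (lborel \<Otimes>\<^sub>M (lborel :: 'b measure)). fst p \<notin> N} \<in> sets (lborel \<Otimes>\<^sub>M lborel)"
      by measurable
    show "AE x in lborel. AE y in (lborel :: 'b measure). fst (x, y) \<notin> N"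
      using AE_not_in[OF N(2)] by auto
  qed
  then show ?thesis using N(1) unfolding lborel_prod by (auto elim!: eventually_mono)
qed

text \<open>
  Two sets that agree almost everywhere meet the same open intervals in positive measure, which
  determines the left endpoint of an open set that is a half-line up to a null set.
\<close>
lemma open_eq_AE_atLeast:
  fixes S :: "real set"
  assumes "open S" "AE u in lborel. a \<le> u \<longleftrightarrow> u \<in> S"
  shows "S \<noteq> {}" "bdd_below S" "Inf S = a"
proof -
  have lb: "a \<le> u" if "u \<in> S" for u
  proof (rule ccontr)
    assume "\<not> a \<le> u"
    then have "S \<inter> {..<a} \<noteq> {}" using that by auto
    with assms obtain v where "v \<in> S \<inter> {..<a}" "a \<le> v \<longleftrightarrow> v \<in> S"
      by (elim AE_open_nonempty[where U = "S \<inter> {..<a}"]) auto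
    then show False by auto
  qed
  have near: "\<exists>u\<in>S. u < b" if "a < b" for b
  proof -
    obtain v where "v \<in> {a<..<b}" "a \<le> v \<longleftrightarrow> v \<in> S"
      using assms(2) by (rule AE_open_nonempty[where U = "{a<..<b}"]) (use \<open>a < b\<close> in auto)
    then show ?thesis by auto
  qed
  show "S \<noteq> {}" using near[of "a + 1"] by auto
  show bdd: "bdd_below S" unfolding bdd_below_def using lb by blast
  show "Inf S = a"
  proof (rule antisym)
    show "a \<le> Inf S" using \<open>S \<noteq> {}\<close> lb by (intro cInf_greatest)
    show "Inf S \<le> a"
    proof (rule field_le_epsilon)
      fix e :: real assume "0 < e"
      then obtain u where "u \<in> S" "u < a + e" using near[of "a + e"] by auto
      then show "Inf S \<le> a + e" using cInf_lower[OF \<open>u \<in> S\<close> bdd] by simp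
    qed
  qed
qed

text \<open>
  Let \<open>U\<close> be the open convex set that agrees almost everywhere with the epigraph of \<open>psi s \<circ> f\<close>, and
  let \<open>G x\<close> be the infimum of its section at \<open>x\<close>. Then \<open>G\<close> is convex and agrees with \<open>psi s \<circ> f\<close>
  almost everywhere, and \<open>psi_inv s \<circ> G\<close> is the \<open>s\<close>-concave function sought, provided that \<open>G\<close> takes
  values at which \<open>psi_inv\<close> inverts. A section unbounded below would by convexity force all sections
  over a ball to be unbounded below. If \<open>s < 0\<close> and \<open>G x \<le> 0\<close>, then \<open>G\<close> is at most \<open>t L\<close> on the ball
  of radius \<open>t \<rho>\<close> around \<open>x\<close>; there \<open>f\<close> is at least \<open>(t L) powr (1 / s)\<close>, and has a mass of order
  \<open>t powr (d + 1 / s)\<close>. The exponent is negative because \<open>s > - 1 / d\<close>, so \<open>f\<close> would have infinite mass.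
\<close>
theorem AE_midpoint_concave_imp_s_concave_density:
  fixes f :: "'a::euclidean_space \<Rightarrow> real"
  assumes f[measurable]: "f \<in> borel_measurable borel" and nonneg: "\<And>x. 0 \<le> f x"
    and finite_mass: "(\<integral>\<^sup>+x. ennreal (f x) \<partial>lborel) < \<infinity>"
    and s: "s > - 1 / real DIM('a)"
    and mid: "AE x in lborel. AE y in lborel. 0 < f x \<and> 0 < f y \<longrightarrow>
      0 < f (midpoint x y) \<and> psi s (f (midpoint x y)) \<le> (psi s (f x) + psi s (f y)) / 2"
  shows "s_concave_density s f"
proof -
  define E where "E = {p :: 'a \<times> real. 0 < f (fst p) \<and> psi s (f (fst p)) \<le> snd p}"
  have "E \<in> sets borel"
  proof -
    have "{p \<in> space (borel \<Otimes>\<^sub>M borel). 0 < f (fst p) \<and> psi s (f (fst p)) \<le> snd p} \<in> sets (borel \<Otimes>\<^sub>M (borel :: real measure))"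
      by measurable
    then show ?thesis by (simp add: E_def space_pair_measure flip: borel_prod)
  qed
  moreover have "AE p in lborel. AE q in lborel. p \<in> E \<and> q \<in> E \<longrightarrow> midpoint p q \<in> E"
    using AE_lborel_fst[OF mid]
  proof eventually_elim
    case (elim p)
    from AE_lborel_fst[OF this] show ?case
    proof eventually_elim
      case (elim q)
      have "midpoint p q = (midpoint (fst p) (fst q), (snd p + snd q) / 2)"
        by (simp add: midpoint_def prod_eq_iff)
      then show ?case using elim by (auto simp: E_def)
    qed
  qed
  ultimately obtain U where U: "open U" "convex U" and EU: "AE p in lborel. p \<in> E \<longleftrightarrow> p \<in> U"
    by (rule AE_midpoint_closed_imp_AE_eq_convex)
  define sec where "sec x = {u. (x, u) \<in> U}" for x
  have open_sec: "open (sec x)" for x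
    unfolding sec_def using open_vimage[OF U(1), of "\<lambda>u. (x, u)"]
    by (simp add: vimage_def continuous_on_Pair continuous_on_const continuous_on_id)
  define G where "G x = Inf (sec x)" for x
  have sec: "AE x in lborel. if 0 < f x then sec x \<noteq> {} \<and> bdd_below (sec x) \<and> G x = psi s (f x)
    else sec x = {}"
  proof -
    have "AE p in lborel \<Otimes>\<^sub>M lborel. p \<in> E \<longleftrightarrow> p \<in> U" using EU unfolding lborel_prod .
    from lborel_pair.AE_pair[OF this] show ?thesis
    proof eventually_elim
      case (elim x)
      show ?case
      proof (cases "0 < f x")
        case True
        then have "AE u in lborel. psi s (f x) \<le> u \<longleftrightarrow> u \<in> sec x"
          using elim by (simp add: E_def sec_def)
        from open_eq_AE_atLeast[OF open_sec this] True show ?thesis by (simp add: G_def)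
      next
        case False
        then have "AE u in lborel. u \<notin> sec x" using elim by (simp add: E_def sec_def)
        then have "sec x = {}"
          using AE_open_nonempty[OF _ open_sec[of x], of "\<lambda>u. u \<notin> sec x"] by blast
        with False show ?thesis by simp
      qed
    qed
  qed
  have sec_comb: "(1 - t) * u + t * v \<in> sec ((1 - t) *\<^sub>R x + t *\<^sub>R y)"
    if "u \<in> sec x" "v \<in> sec y" "0 \<le> t" "t \<le> 1" for u v x y t
    using convexD_alt[OF U(2), of "(x, u)" "(y, v)" t] that by (simp add: sec_def)
  have sec_ball: "\<exists>\<rho>>0. \<forall>y\<in>ball x \<rho>. u \<in> sec y" if "u \<in> sec x" for x u
  proof -
    have "open ((\<lambda>y. (y, u)) -` U)"
      by (intro open_vimage U) (intro continuous_intros)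
    moreover have "x \<in> (\<lambda>y. (y, u)) -` U" using that by (simp add: sec_def)
    ultimately show ?thesis unfolding open_contains_ball sec_def by blast
  qed
  have sec_shrink: "(1 - t) * u + t * v \<in> sec z"
    if "u \<in> sec x" "\<forall>y\<in>ball x \<rho>. v \<in> sec y" "0 < t" "t < 1" "z \<in> ball x (t * \<rho>)" for u v x z t \<rho>
  proof -
    define y where "y = x + (1 / t) *\<^sub>R (z - x)"
    have "dist x y = (1 / t) * dist x z" using that(3) by (simp add: y_def dist_norm norm_minus_commute)
    then have "t * dist x y < t * \<rho>" using that by (simp add: mult.commute)
    then have "y \<in> ball x \<rho>" using that(3) by simp
    then have "(1 - t) * u + t * v \<in> sec ((1 - t) *\<^sub>R x + t *\<^sub>R y)"
      using that by (intro sec_comb) auto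
    also have "(1 - t) *\<^sub>R x + t *\<^sub>R y = z" using that(3) by (simp add: y_def algebra_simps)
    finally show ?thesis .
  qed
  have bdd: "bdd_below (sec x)" for x
  proof (rule ccontr)
    assume *: "\<not> bdd_below (sec x)"
    then have "sec x \<noteq> {}" by auto
    then obtain v where "v \<in> sec x" by blast
    then obtain \<rho> where \<rho>: "\<rho> > 0" "\<forall>y\<in>ball x \<rho>. v \<in> sec y" using sec_ball by blast
    \<comment> \<open>Every section over this ball inherits unboundedness from \<open>sec x\<close>, but almost every one is bounded.\<close>
    obtain z where z: "z \<in> ball x (1/2 * \<rho>)"
      "if 0 < f z then sec z \<noteq> {} \<and> bdd_below (sec z) \<and> G z = psi s (f z) else sec z = {}"
      using sec by (rule AE_open_nonempty[where U = "ball x (1/2 * \<rho>)"]) (use \<rho> in auto)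
    have "bdd_below (sec z)" using z(2) by (auto split: if_splits)
    then obtain b where b: "\<And>u. u \<in> sec z \<Longrightarrow> b \<le> u" by (auto simp: bdd_below_def)
    have "2 * b - v \<le> u" if "u \<in> sec x" for u
      using b[OF sec_shrink[OF that \<rho>(2) _ _ z(1)]] by (simp add: field_simps)
    with * show False by (auto simp: bdd_below_def)
  qed
  have conv: "sec ((1 - t) *\<^sub>R x + t *\<^sub>R y) \<noteq> {} \<and>
      G ((1 - t) *\<^sub>R x + t *\<^sub>R y) \<le> (1 - t) * G x + t * G y"
    if ne: "sec x \<noteq> {}" "sec y \<noteq> {}" and t: "0 < t" "t < 1" for x y t
  proof
    let ?w = "(1 - t) *\<^sub>R x + t *\<^sub>R y"
    obtain u v where "u \<in> sec x" "v \<in> sec y" using ne by blast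
    then have "(1 - t) * u + t * v \<in> sec ?w" using t by (intro sec_comb) auto
    then show "sec ?w \<noteq> {}" by blast
    have le: "G ?w \<le> (1 - t) * u + t * v" if "u \<in> sec x" "v \<in> sec y" for u v
      unfolding G_def using that \<open>0 < t\<close> \<open>t < 1\<close> by (intro cInf_lower sec_comb bdd) auto
    have le': "(G ?w - t * v) / (1 - t) \<le> G x" if "v \<in> sec y" for v
      unfolding G_def[of x]
    proof (rule cInf_greatest[OF ne(1)])
      fix u assume "u \<in> sec x"
      from le[OF this \<open>v \<in> sec y\<close>] t show "(G ?w - t * v) / (1 - t) \<le> u"
        by (simp add: pos_divide_le_eq mult.commute)
    qed
    have "(G ?w - (1 - t) * G x) / t \<le> G y"
      unfolding G_def[of y]
    proof (rule cInf_greatest[OF ne(2)])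
      fix v assume "v \<in> sec y"
      from le'[OF this] t show "(G ?w - (1 - t) * G x) / t \<le> v"
        by (simp add: pos_divide_le_eq mult.commute)
    qed
    then show "G ?w \<le> (1 - t) * G x + t * G y"
      using t by (simp add: pos_divide_le_eq mult.commute)
  qed
  have G_pos: "0 < G x" if "s < 0" "sec x \<noteq> {}" for x
  proof (rule ccontr)
    assume "\<not> 0 < G x"
    have near: "\<exists>u\<in>sec x. u < \<delta>" if "0 < \<delta>" for \<delta>
      using that \<open>\<not> 0 < G x\<close> \<open>sec x \<noteq> {}\<close> bdd[of x] cInf_less_iff[of "sec x" \<delta>] by (simp add: G_def)
    obtain v where "v \<in> sec x" using \<open>sec x \<noteq> {}\<close> by blast
    then obtain \<rho> where \<rho>: "\<rho> > 0" "\<forall>y\<in>ball x \<rho>. v \<in> sec y" using sec_ball by blast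
    define L where "L = 1 + \<bar>v\<bar>"
    have "L > 0" by (simp add: L_def add_pos_nonneg)
    define d where "d = real DIM('a)"
    have "d > 0" by (simp add: d_def)
    define K where "K = unit_ball_vol d * \<rho> ^ DIM('a) * L powr (1 / s)"
    have "K > 0" unfolding K_def using \<rho> \<open>L > 0\<close> by (intro mult_pos_pos) (auto simp: d_def)
    obtain I where I: "(\<integral>\<^sup>+x. ennreal (f x) \<partial>lborel) = ennreal I" "I \<ge> 0"
      using finite_mass by (cases "\<integral>\<^sup>+x. ennreal (f x) \<partial>lborel") auto
    have lower: "K * t powr (d + 1 / s) \<le> I" if t: "0 < t" "t < 1" for t
    proof -
      obtain u where u: "u \<in> sec x" "u < t" using near t by blast
      have "AE z in lborel. ennreal ((t * L) powr (1 / s)) * indicator (ball x (t * \<rho>)) z \<le> ennreal (f z)"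
        using sec
      proof eventually_elim
        case (elim z)
        show ?case
        proof (cases "z \<in> ball x (t * \<rho>)")
          case True
          have m: "(1 - t) * u + t * v \<in> sec z" using u \<rho> t True by (intro sec_shrink) auto
          then have "0 < f z" "G z = psi s (f z)" using elim by (auto split: if_splits)
          have "psi s (f z) \<le> (1 - t) * u + t * v"
            unfolding \<open>G z = psi s (f z)\<close>[symmetric] G_def by (intro cInf_lower m bdd)
          also have "(1 - t) * u + t * v \<le> t * L"
          proof -
            have "(1 - t) * u \<le> (1 - t) * t" using u t by (intro mult_left_mono) auto
            also have "\<dots> \<le> t" using t by (simp add: algebra_simps)
            finally show ?thesis using t by (simp add: L_def algebra_simps)
              (smt (verit) mult_left_mono abs_ge_self)
          qed
          also have "t * L = psi s ((t * L) powr (1 / s))"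
            using \<open>s < 0\<close> \<open>L > 0\<close> t by (simp add: psi_def powr_powr)
          finally have "(t * L) powr (1 / s) \<le> f z"
            using \<open>0 < f z\<close> t \<open>L > 0\<close> by (subst (asm) psi_le_iff) auto
          then show ?thesis using True by (simp add: ennreal_leI)
        qed simp
      qed
      then have "(\<integral>\<^sup>+z. ennreal ((t * L) powr (1 / s)) * indicator (ball x (t * \<rho>)) z \<partial>lborel) \<le> ennreal I"
        unfolding I(1)[symmetric] by (rule nn_integral_mono_AE)
      then have "ennreal ((t * L) powr (1 / s)) * ennreal (unit_ball_vol d * (t * \<rho>) ^ DIM('a)) \<le> ennreal I"
        using t \<rho>(1) by (simp add: nn_integral_cmult_indicator emeasure_ball d_def)
      then have "(t * L) powr (1 / s) * (unit_ball_vol d * (t * \<rho>) ^ DIM('a)) \<le> I"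
        using I(2) by (simp add: ennreal_mult'[symmetric] ennreal_le_iff)
      also have "(t * L) powr (1 / s) * (unit_ball_vol d * (t * \<rho>) ^ DIM('a)) = K * t powr (d + 1 / s)"
        using t \<open>L > 0\<close> by (simp add: K_def powr_mult power_mult_distrib powr_add d_def powr_realpow)
      finally show ?thesis .
    qed
    define e where "e = - (d + 1 / s)"
    have "e > 0"
    proof -
      have "- 1 < s * d" using s \<open>d > 0\<close> by (simp add: d_def field_simps)
      then show ?thesis using \<open>s < 0\<close> by (simp add: e_def field_simps)
    qed
    define B where "B = I / K + 2"
    have "0 \<le> I / K" using I(2) \<open>K > 0\<close> by simp
    then have "B > 1" by (simp add: B_def)
    \<comment> \<open>At this scale the lower bound for the mass is \<open>K * B > I\<close>.\<close>
    define t where "t = B powr (- 1 / e)"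
    have "0 < t" "t < 1"
      using \<open>B > 1\<close> \<open>e > 0\<close> powr_less_mono[of "- 1 / e" 0 B] by (auto simp: t_def)
    then have "K * t powr (d + 1 / s) \<le> I" by (rule lower)
    also have "t powr (d + 1 / s) = B"
    proof -
      have "d + 1 / s = - e" by (simp add: e_def)
      then show ?thesis using \<open>e > 0\<close> \<open>B > 1\<close> by (simp add: t_def powr_powr)
    qed
    finally show False using \<open>K > 0\<close> by (simp add: B_def algebra_simps)
  qed
  define g where "g x = (if sec x = {} then 0 else psi_inv s (G x))" for x
  have "AE x in lborel. f x = g x"
    using sec
  proof eventually_elim
    case (elim x)
    then show ?case using nonneg[of x] by (auto simp: g_def psi_inv_psi split: if_splits)
  qed
  moreover have "s_concave s g"
    unfolding s_concave_iff
  proof (intro conjI allI impI)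
    show "0 \<le> g x" for x by (simp add: g_def)
    fix x y t assume xyt: "0 < g x \<and> 0 < g y \<and> 0 < t \<and> (t :: real) < 1"
    let ?w = "(1 - t) *\<^sub>R x + t *\<^sub>R y"
    have ne: "sec x \<noteq> {}" "sec y \<noteq> {}" and pos: "0 < psi_inv s (G x)" "0 < psi_inv s (G y)"
      using xyt by (auto simp: g_def split: if_splits)
    have w: "sec ?w \<noteq> {}" "G ?w \<le> (1 - t) * G x + t * G y" using conv[OF ne] xyt by auto
    have "0 < psi_inv s (G ?w)"
    proof -
      consider "s = 0" | "s < 0" | "s > 0" by linarith
      then show ?thesis
      proof cases
        case 3
        then have "G x < 0" "G y < 0" using pos by (auto simp: psi_inv_pos_iff)
        then have "(1 - t) * G x + t * G y < 0" using xyt by (intro add_neg_neg mult_pos_neg) auto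
        with w(2) 3 show ?thesis by (simp add: psi_inv_pos_iff)
      qed (use G_pos[of ?w] w in \<open>auto simp: psi_inv_pos_iff\<close>)
    qed
    with w pos ne show "0 < g ?w" "psi s (g ?w) \<le> (1 - t) * psi s (g x) + t * psi s (g y)"
      by (simp_all add: g_def psi_psi_inv)
  qed
  ultimately show ?thesis unfolding s_concave_density_def by blast
qed

section \<open>Couplings of two copies of a density\<close>

text \<open>
  A sum of a measure on the diagonal and one with a density. It is obtained as one image measure: a
  truth value selects the summand, and in the diagonal summand the idle second coordinate is uniform
  on the unit cube.
\<close>
lemma diagonal_plus_density_measure:
  fixes a :: "'a::euclidean_space \<Rightarrow> ennreal" and q :: "'a \<times> 'a \<Rightarrow> ennreal"
  assumes [measurable]: "a \<in> borel_measurable borel" "q \<in> borel_measurable (borel \<Otimes>\<^sub>M borel)"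
  obtains Q :: "('a \<times> 'a) measure" where "sets Q = sets (borel \<Otimes>\<^sub>M borel)"
    "\<And>h. h \<in> borel_measurable (borel \<Otimes>\<^sub>M borel) \<Longrightarrow>
      (\<integral>\<^sup>+p. h p \<partial>Q) = (\<integral>\<^sup>+x. a x * h (x, x) \<partial>lborel) + (\<integral>\<^sup>+x. \<integral>\<^sup>+y. q (x, y) * h (x, y) \<partial>lborel \<partial>lborel)"
proof -
  let ?N = "count_space (UNIV :: bool set) \<Otimes>\<^sub>M (lborel \<Otimes>\<^sub>M lborel :: ('a \<times> 'a) measure)"
  have pairs: "sigma_finite_measure (lborel \<Otimes>\<^sub>M lborel :: ('a \<times> 'a) measure)"
    unfolding lborel_prod by (rule sigma_finite_lborel)
  define w :: "bool \<times> 'a \<times> 'a \<Rightarrow> ennreal" where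
    "w t = (if fst t then a (fst (snd t)) * indicator (cbox 0 One) (snd (snd t)) else q (fst (snd t), snd (snd t)))" for t
  have [measurable]: "w \<in> borel_measurable ?N" unfolding w_def by measurable
  define T :: "bool \<times> 'a \<times> 'a \<Rightarrow> 'a \<times> 'a" where "T t = (fst (snd t), if fst t then fst (snd t) else snd (snd t))" for t
  have T[measurable]: "T \<in> measurable ?N (borel \<Otimes>\<^sub>M borel)" unfolding T_def by measurable
  define Q where "Q = distr (density ?N w) (borel \<Otimes>\<^sub>M borel) T"
  show thesis
  proof
    show "sets Q = sets (borel \<Otimes>\<^sub>M borel)" by (simp add: Q_def)
    fix h :: "'a \<times> 'a \<Rightarrow> ennreal" assume h[measurable]: "h \<in> borel_measurable (borel \<Otimes>\<^sub>M borel)"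
    have "(\<integral>\<^sup>+p. h p \<partial>Q) = (\<integral>\<^sup>+t. w t * h (T t) \<partial>?N)"
      unfolding Q_def by (subst nn_integral_distr) (auto simp: nn_integral_density)
    also have "\<dots> = (\<integral>\<^sup>+b. \<integral>\<^sup>+p. w (b, p) * h (T (b, p)) \<partial>(lborel \<Otimes>\<^sub>M lborel) \<partial>count_space UNIV)"
      by (rule sigma_finite_measure.nn_integral_fst[OF pairs, symmetric]) measurable
    also have "\<dots> = (\<integral>\<^sup>+p. w (True, p) * h (T (True, p)) \<partial>(lborel \<Otimes>\<^sub>M lborel))
        + (\<integral>\<^sup>+p. w (False, p) * h (T (False, p)) \<partial>(lborel \<Otimes>\<^sub>M lborel))"
      by (simp add: nn_integral_count_space_finite UNIV_bool add.commute)
    also have "(\<integral>\<^sup>+p. w (True, p) * h (T (True, p)) \<partial>(lborel \<Otimes>\<^sub>M lborel)) =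
        (\<integral>\<^sup>+x. \<integral>\<^sup>+y. a x * h (x, x) * indicator (cbox 0 One :: 'a set) y \<partial>lborel \<partial>lborel)"
      by (subst lborel.nn_integral_fst[symmetric], measurable) (simp add: w_def T_def mult.assoc mult.left_commute mult.commute)
    also have "\<dots> = (\<integral>\<^sup>+x. a x * h (x, x) \<partial>lborel)"
      by (simp add: nn_integral_cmult_indicator emeasure_lborel_cbox_eq)
    also have "(\<integral>\<^sup>+p. w (False, p) * h (T (False, p)) \<partial>(lborel \<Otimes>\<^sub>M lborel)) =
        (\<integral>\<^sup>+x. \<integral>\<^sup>+y. q (x, y) * h (x, y) \<partial>lborel \<partial>lborel)"
      by (subst lborel.nn_integral_fst[symmetric]) (auto simp: w_def T_def intro!: nn_integral_cong)
    finally show "(\<integral>\<^sup>+p. h p \<partial>Q) = (\<integral>\<^sup>+x. a x * h (x, x) \<partial>lborel) +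
        (\<integral>\<^sup>+x. \<integral>\<^sup>+y. q (x, y) * h (x, y) \<partial>lborel \<partial>lborel)" .
  qed
qed

lemma distributed_lborelI:
  fixes X :: "'w \<Rightarrow> 'a::euclidean_space"
  assumes [measurable]: "X \<in> borel_measurable M" "g \<in> borel_measurable borel"
    and eq: "\<And>A. A \<in> sets borel \<Longrightarrow> (\<integral>\<^sup>+w. indicator A (X w) \<partial>M) = (\<integral>\<^sup>+x. g x * indicator A x \<partial>lborel)"
  shows "distributed M lborel X g"
  unfolding distributed_def
proof (intro conjI)
  show "distr M lborel X = density lborel g"
  proof (rule measure_eqI)
    fix A assume "A \<in> sets (distr M lborel X)"
    then have [measurable]: "A \<in> sets borel" by simp
    have "emeasure (distr M lborel X) A = (\<integral>\<^sup>+x. indicator A x \<partial>distr M lborel X)" by simp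
    also have "\<dots> = (\<integral>\<^sup>+w. indicator A (X w) \<partial>M)" by (rule nn_integral_distr) simp_all
    also have "\<dots> = emeasure (density lborel g) A" by (simp add: eq emeasure_density)
    finally show "emeasure (distr M lborel X) A = emeasure (density lborel g) A" .
  qed simp
qed simp_all

text \<open>
  Weights under which a sum of \<open>n\<close> vectors is the midpoint of the first two.
\<close>
definition midpoint_weights :: "nat \<Rightarrow> real" where
  "midpoint_weights i = (if i \<le> 2 then 1 / 2 else 0)"

lemma midpoint_weights_sum:
  fixes x :: "nat \<Rightarrow> 'a::real_vector"
  assumes "n \<ge> 2"
  shows "(\<Sum>i=1..n. midpoint_weights i *\<^sub>R x i) = midpoint (x 1) (x 2)"
proof -
  have "(\<Sum>i=1..n. midpoint_weights i *\<^sub>R x i) = (\<Sum>i\<in>{1,2}. midpoint_weights i *\<^sub>R x i)"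
    using assms by (intro sum.mono_neutral_right) (auto simp: midpoint_weights_def)
  also have "\<dots> = midpoint (x 1) (x 2)"
    by (simp add: midpoint_weights_def midpoint_def scaleR_add_right inverse_eq_divide)
  finally show ?thesis .
qed

lemma midpoint_weights_real_sum:
  "n \<ge> 2 \<Longrightarrow> (\<Sum>i=1..n. midpoint_weights i) = 1"
  using midpoint_weights_sum[of n "\<lambda>_. 1 :: real"] by simp

text \<open>
  The substitution \<open>y = 2 z - x\<close> at fixed \<open>x\<close>: if a pair has density \<open>q\<close>, then its midpoint has the
  density that multiplies \<open>h\<close> on the right.
\<close>
lemma nn_integral_midpoint:
  fixes q :: "'a::euclidean_space \<times> 'a \<Rightarrow> ennreal" and h :: "'a \<Rightarrow> ennreal"
  assumes [measurable]: "q \<in> borel_measurable (borel \<Otimes>\<^sub>M borel)" "h \<in> borel_measurable borel"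
  shows "(\<integral>\<^sup>+x. \<integral>\<^sup>+y. q (x, y) * h (midpoint x y) \<partial>lborel \<partial>lborel) =
    (\<integral>\<^sup>+z. ennreal (2 ^ DIM('a)) * (\<integral>\<^sup>+x. q (x, 2 *\<^sub>R z - x) \<partial>lborel) * h z \<partial>lborel)"
proof -
  have "(\<integral>\<^sup>+y. q (x, y) * h (midpoint x y) \<partial>lborel) =
      (\<integral>\<^sup>+z. ennreal (2 ^ DIM('a)) * (q (x, 2 *\<^sub>R z - x) * h z) \<partial>lborel)" for x :: 'a
  proof -
    have "(\<integral>\<^sup>+y. q (x, y) * h (midpoint x y) \<partial>lborel) =
        ennreal (\<bar>2\<bar> ^ DIM('a)) * (\<integral>\<^sup>+z. q (x, - x + 2 *\<^sub>R z) * h (midpoint x (- x + 2 *\<^sub>R z)) \<partial>lborel)"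
    proof (rule nn_integral_lborel_affine)
      show "(\<lambda>y. q (x, y) * h (midpoint x y)) \<in> borel_measurable borel"
        unfolding midpoint_def by measurable
    qed simp
    also have "\<dots> = ennreal (2 ^ DIM('a)) * (\<integral>\<^sup>+z. q (x, 2 *\<^sub>R z - x) * h z \<partial>lborel)"
      by (simp add: midpoint_def)
    also have "\<dots> = (\<integral>\<^sup>+z. ennreal (2 ^ DIM('a)) * (q (x, 2 *\<^sub>R z - x) * h z) \<partial>lborel)"
      by (rule nn_integral_cmult[symmetric]) measurable
    finally show ?thesis .
  qed
  then have "(\<integral>\<^sup>+x. \<integral>\<^sup>+y. q (x, y) * h (midpoint x y) \<partial>lborel \<partial>lborel) =
      (\<integral>\<^sup>+x. \<integral>\<^sup>+z. ennreal (2 ^ DIM('a)) * (q (x, 2 *\<^sub>R z - x) * h z) \<partial>lborel \<partial>lborel)"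
    by simp
  also have "\<dots> = (\<integral>\<^sup>+z. \<integral>\<^sup>+x. ennreal (2 ^ DIM('a)) * (q (x, 2 *\<^sub>R z - x) * h z) \<partial>lborel \<partial>lborel)"
    by (rule lborel_pair.Fubini') measurable
  also have "\<dots> = (\<integral>\<^sup>+z. ennreal (2 ^ DIM('a)) * (\<integral>\<^sup>+x. q (x, 2 *\<^sub>R z - x) \<partial>lborel) * h z \<partial>lborel)"
    by (simp add: nn_integral_cmult nn_integral_multc mult.assoc)
  finally show ?thesis .
qed

text \<open>
  Symmetry of \<open>q\<close> gives both coordinates the same marginal. The vectors after the second are copies
  of the first.
\<close>
lemma coupling_of_diagonal_plus_density:
  fixes f :: "'a::euclidean_space \<Rightarrow> real"
  assumes f: "prob_density f" and n: "n \<ge> 2"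
    and a[measurable]: "a \<in> borel_measurable borel" and q[measurable]: "q \<in> borel_measurable (borel \<Otimes>\<^sub>M borel)"
    and sym: "\<And>x y. q (x, y) = q (y, x)"
    and marginal: "\<And>x. a x + (\<integral>\<^sup>+y. q (x, y) \<partial>lborel) = ennreal (f x)"
    and g: "g \<in> borel_measurable borel" "\<And>z. 0 \<le> g z"
      "\<And>z. ennreal (g z) = a z + ennreal (2 ^ DIM('a)) * (\<integral>\<^sup>+x. q (x, 2 *\<^sub>R z - x) \<partial>lborel)"
  shows "prob_density g"
    and "\<exists>P\<in>couplings n f. distributed P lborel (\<lambda>X. \<Sum>i=1..n. midpoint_weights i *\<^sub>R X i) (\<lambda>x. ennreal (g x))"
proof -
  note [measurable] = g(1)
  have [measurable]: "f \<in> borel_measurable borel" using f by (simp add: prob_density_def)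
  obtain Q :: "('a \<times> 'a) measure" where sets_Q[measurable_cong]: "sets Q = sets (borel \<Otimes>\<^sub>M borel)"
    and Q: "\<And>h. h \<in> borel_measurable (borel \<Otimes>\<^sub>M borel) \<Longrightarrow>
      (\<integral>\<^sup>+p. h p \<partial>Q) = (\<integral>\<^sup>+x. a x * h (x, x) \<partial>lborel) + (\<integral>\<^sup>+x. \<integral>\<^sup>+y. q (x, y) * h (x, y) \<partial>lborel \<partial>lborel)"
    using diagonal_plus_density_measure[OF a q] by blast
  have D1: "distributed Q lborel fst (\<lambda>x. ennreal (f x))"
  proof (rule distributed_lborelI)
    fix A :: "'a set" assume [measurable]: "A \<in> sets borel"
    have "(\<integral>\<^sup>+p. indicator A (fst p) \<partial>Q) = (\<integral>\<^sup>+x. a x * indicator A x \<partial>lborel) + (\<integral>\<^sup>+x. \<integral>\<^sup>+y. q (x, y) * indicator A x \<partial>lborel \<partial>lborel)"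
      by (subst Q) auto
    also have "\<dots> = (\<integral>\<^sup>+x. (a x + (\<integral>\<^sup>+y. q (x, y) \<partial>lborel)) * indicator A x \<partial>lborel)"
      by (simp add: nn_integral_multc nn_integral_add[symmetric] distrib_right)
    finally show "(\<integral>\<^sup>+p. indicator A (fst p) \<partial>Q) = (\<integral>\<^sup>+x. ennreal (f x) * indicator A x \<partial>lborel)"
      by (simp add: marginal)
  qed simp_all
  have D2: "distributed Q lborel snd (\<lambda>x. ennreal (f x))"
  proof (rule distributed_lborelI)
    fix A :: "'a set" assume [measurable]: "A \<in> sets borel"
    have "(\<integral>\<^sup>+p. indicator A (snd p) \<partial>Q) = (\<integral>\<^sup>+x. a x * indicator A x \<partial>lborel) + (\<integral>\<^sup>+x. \<integral>\<^sup>+y. q (x, y) * indicator A y \<partial>lborel \<partial>lborel)"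
      by (subst Q) auto
    also have "(\<integral>\<^sup>+x. \<integral>\<^sup>+y. q (x, y) * indicator A y \<partial>lborel \<partial>lborel) = (\<integral>\<^sup>+y. \<integral>\<^sup>+x. q (x, y) * indicator A y \<partial>lborel \<partial>lborel)"
      by (rule lborel_pair.Fubini') measurable
    also have "\<dots> = (\<integral>\<^sup>+y. \<integral>\<^sup>+x. q (y, x) * indicator A y \<partial>lborel \<partial>lborel)"
      by (subst sym) simp
    also have "(\<integral>\<^sup>+x. a x * indicator A x \<partial>lborel) + \<dots> = (\<integral>\<^sup>+x. (a x + (\<integral>\<^sup>+y. q (x, y) \<partial>lborel)) * indicator A x \<partial>lborel)"
      by (simp add: nn_integral_multc nn_integral_add[symmetric] distrib_right)
    finally show "(\<integral>\<^sup>+p. indicator A (snd p) \<partial>Q) = (\<integral>\<^sup>+x. ennreal (f x) * indicator A x \<partial>lborel)"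
      by (simp add: marginal)
  qed simp_all
  have D3: "distributed Q lborel (\<lambda>p. midpoint (fst p) (snd p)) (\<lambda>x. ennreal (g x))"
  proof (rule distributed_lborelI)
    show "(\<lambda>p. midpoint (fst p) (snd p)) \<in> borel_measurable Q" unfolding midpoint_def by measurable
    fix A :: "'a set" assume [measurable]: "A \<in> sets borel"
    have "(\<integral>\<^sup>+p. indicator A (midpoint (fst p) (snd p)) \<partial>Q) = (\<integral>\<^sup>+x. a x * indicator A x \<partial>lborel)
        + (\<integral>\<^sup>+x. \<integral>\<^sup>+y. q (x, y) * indicator A (midpoint x y) \<partial>lborel \<partial>lborel)"
      by (subst Q) (auto simp: midpoint_def)
    also have "(\<integral>\<^sup>+x. \<integral>\<^sup>+y. q (x, y) * indicator A (midpoint x y) \<partial>lborel \<partial>lborel)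
        = (\<integral>\<^sup>+z. ennreal (2 ^ DIM('a)) * (\<integral>\<^sup>+x. q (x, 2 *\<^sub>R z - x) \<partial>lborel) * indicator A z \<partial>lborel)"
      by (rule nn_integral_midpoint) measurable
    also have "(\<integral>\<^sup>+x. a x * indicator A x \<partial>lborel) + \<dots> = (\<integral>\<^sup>+z. (a z + ennreal (2 ^ DIM('a)) * (\<integral>\<^sup>+x. q (x, 2 *\<^sub>R z - x) \<partial>lborel)) * indicator A z \<partial>lborel)"
      by (simp add: nn_integral_add[symmetric] distrib_right)
    finally show "(\<integral>\<^sup>+p. indicator A (midpoint (fst p) (snd p)) \<partial>Q) = (\<integral>\<^sup>+x. ennreal (g x) * indicator A x \<partial>lborel)"
      by (simp add: g(3))
  qed simp_all
  have mass_Q: "emeasure Q (space Q) = 1"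
    using distributed_nn_integral[OF D1, of "\<lambda>_. 1"] f by (simp add: prob_density_def)
  then show "prob_density g"
    using distributed_nn_integral[OF D3, of "\<lambda>_. 1"] g by (simp add: prob_density_def)
  define c :: "'a \<times> 'a \<Rightarrow> nat \<Rightarrow> 'a" where "c p = (\<lambda>i\<in>{1..n}. if i = 2 then snd p else fst p)" for p
  have c: "c \<in> measurable Q (\<Pi>\<^sub>M i\<in>{1..n}. borel)" unfolding c_def by measurable
  define P where "P = distr Q (\<Pi>\<^sub>M i\<in>{1..n}. borel) c"
  have push: "distributed P lborel Y h" if "distributed Q lborel (\<lambda>p. Y (c p)) h"
      "Y \<in> borel_measurable (\<Pi>\<^sub>M i\<in>{1..n}. borel)" for Y :: "(nat \<Rightarrow> 'a) \<Rightarrow> 'a" and h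
    using that c unfolding distributed_def P_def by (simp add: distr_distr comp_def)
  have "P \<in> couplings n f"
    unfolding couplings_def
  proof (intro CollectI conjI ballI)
    interpret Q: prob_space Q using mass_Q by (rule prob_spaceI)
    show "prob_space P" unfolding P_def using c by (rule Q.prob_space_distr)
    show "sets P = sets (\<Pi>\<^sub>M i\<in>{1..n}. borel)" by (simp add: P_def)
    fix i assume i: "i \<in> {1..n}"
    then have "(\<lambda>p. c p i) = (if i = 2 then snd else fst)" by (auto simp: c_def)
    then show "distributed P lborel (\<lambda>X. X i) (\<lambda>x. ennreal (f x))"
      using i D1 D2 by (intro push) (auto split: if_splits)
  qed
  moreover have "distributed P lborel (\<lambda>X. \<Sum>i=1..n. midpoint_weights i *\<^sub>R X i) (\<lambda>x. ennreal (g x))"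
  proof (rule push)
    show "distributed Q lborel (\<lambda>p. \<Sum>i=1..n. midpoint_weights i *\<^sub>R c p i) (\<lambda>x. ennreal (g x))"
      unfolding midpoint_weights_sum[OF n] using D3 n by (simp add: c_def)
  qed measurable
  ultimately show "\<exists>P\<in>couplings n f. distributed P lborel (\<lambda>X. \<Sum>i=1..n. midpoint_weights i *\<^sub>R X i) (\<lambda>x. ennreal (g x))"
    by blast
qed

text \<open>
  The form in which couplings are used below: \<open>a\<close> is the density of the mass left on the diagonal and
  \<open>p\<close> that of the midpoints of the pairs distributed by \<open>q\<close>.
\<close>
lemma midpoint_coupling:
  fixes f :: "'a::euclidean_space \<Rightarrow> real"
  assumes f: "prob_density f" and n: "n \<ge> 2"
    and a: "a \<in> borel_measurable borel" "\<And>x. 0 \<le> a x"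
    and q: "q \<in> borel_measurable (borel \<Otimes>\<^sub>M borel)"
    and sym: "\<And>x y. q (x, y) = q (y, x)"
    and marginal: "\<And>x. ennreal (a x) + (\<integral>\<^sup>+y. q (x, y) \<partial>lborel) = ennreal (f x)"
    and p: "p \<in> borel_measurable borel" "\<And>z. 0 \<le> p z"
      "\<And>z. ennreal (p z) = ennreal (2 ^ DIM('a)) * (\<integral>\<^sup>+x. q (x, 2 *\<^sub>R z - x) \<partial>lborel)"
  shows "prob_density (\<lambda>z. a z + p z)"
    and "\<exists>P\<in>couplings n f. distributed P lborel (\<lambda>X. \<Sum>i=1..n. midpoint_weights i *\<^sub>R X i) (\<lambda>z. ennreal (a z + p z))"
  using coupling_of_diagonal_plus_density[OF f n _ q sym marginal, of "\<lambda>z. a z + p z"] a p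
  by (simp_all add: ennreal_plus)

section \<open>Entropy as a monotone function of an integral\<close>

lemma prob_density_measurable: "prob_density f \<Longrightarrow> f \<in> borel_measurable borel"
  and prob_density_nonneg: "prob_density f \<Longrightarrow> 0 \<le> f x"
  and nn_integral_prob_density: "prob_density f \<Longrightarrow> (\<integral>\<^sup>+x. ennreal (f x) \<partial>lborel) = 1"
  by (auto simp: prob_density_def)

lemma integrable_prob_density:
  assumes "prob_density f" shows "integrable lborel f" "integral\<^sup>L lborel f = 1"
  using assms by (auto simp: prob_density_def integrable_iff_bounded integral_eq_nn_integral)

lemma phi_neq_1: "r \<noteq> 1 \<Longrightarrow> 0 \<le> u \<Longrightarrow> phi r u = - sgn (r - 1) * u powr r"
  by (simp add: phi_def psi_def powr_mult_base)

lemma phi_1: "phi 1 u = - (u * ln u)"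
  by (simp add: phi_def psi_def)

lemma phi_nonneg: "r < 1 \<Longrightarrow> 0 \<le> u \<Longrightarrow> 0 \<le> phi r u"
  by (simp add: phi_neq_1)

lemma phi_nonpos: "r > 1 \<Longrightarrow> 0 \<le> u \<Longrightarrow> phi r u \<le> 0"
  by (simp add: phi_neq_1)

lemma nn_integral_powr_nonzero:
  assumes f: "prob_density f" and r: "r \<noteq> 1"
  shows "(\<integral>\<^sup>+x. ennreal (f x powr r) \<partial>lborel) \<noteq> 0"
proof
  note [measurable] = prob_density_measurable[OF f]
  assume "(\<integral>\<^sup>+x. ennreal (f x powr r) \<partial>lborel) = 0"
  then have "AE x in lborel. f x = 0"
    using prob_density_nonneg[OF f] by (simp add: nn_integral_0_iff_AE)
  then have "(\<integral>\<^sup>+x. ennreal (f x) \<partial>lborel) = (\<integral>\<^sup>+x. 0 \<partial>(lborel :: 'a measure))"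
    by (intro nn_integral_cong_AE) (auto elim!: eventually_mono)
  then show False using nn_integral_prob_density[OF f] by simp
qed

text \<open>
  For \<open>r \<noteq> 1\<close> the function \<open>phi r\<close> has one sign, so that only one of its two parts contributes.
\<close>
lemma renyi_entropy_phi:
  fixes f :: "'a::euclidean_space \<Rightarrow> real"
  assumes f: "\<And>x. 0 \<le> f x"
  shows "r = 1 \<Longrightarrow> renyi_entropy r f = enn2ereal (\<integral>\<^sup>+x. ennreal (phi r (f x)) \<partial>lborel) - enn2ereal (\<integral>\<^sup>+x. ennreal (- phi r (f x)) \<partial>lborel)"
    and "r < 1 \<Longrightarrow> renyi_entropy r f = ereal (1 / (1 - r)) * ext_ln (\<integral>\<^sup>+x. ennreal (phi r (f x)) \<partial>lborel)"
    and "r > 1 \<Longrightarrow> renyi_entropy r f = ereal (1 / (1 - r)) * ext_ln (\<integral>\<^sup>+x. ennreal (- phi r (f x)) \<partial>lborel)"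
  using f by (simp_all add: renyi_entropy_def phi_1 phi_neq_1)

lemma nn_integral_phi_trivial:
  fixes f :: "'a::euclidean_space \<Rightarrow> real"
  assumes f: "\<And>x. 0 \<le> f x"
  shows "r < 1 \<Longrightarrow> (\<integral>\<^sup>+x. ennreal (- phi r (f x)) \<partial>lborel) = 0"
    and "r > 1 \<Longrightarrow> (\<integral>\<^sup>+x. ennreal (phi r (f x)) \<partial>lborel) = 0"
  using f by (simp_all add: phi_nonneg phi_nonpos ennreal_neg)

lemma renyi_entropy_defined_iff:
  fixes f :: "'a::euclidean_space \<Rightarrow> real"
  assumes f: "\<And>x. 0 \<le> f x"
  shows "renyi_entropy_defined r f \<longleftrightarrow>
    (\<integral>\<^sup>+x. ennreal (phi r (f x)) \<partial>lborel) < \<infinity> \<or> (\<integral>\<^sup>+x. ennreal (- phi r (f x)) \<partial>lborel) < \<infinity>"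
proof -
  consider "r = 1" | "r < 1" | "r > 1" by linarith
  then show ?thesis
    by cases (use nn_integral_phi_trivial[of f r, OF f] in \<open>auto simp: renyi_entropy_defined_def phi_1\<close>)
qed

lemma renyi_entropy_eq_infinity:
  fixes f :: "'a::euclidean_space \<Rightarrow> real"
  assumes f: "\<And>x. 0 \<le> f x"
    and "(\<integral>\<^sup>+x. ennreal (phi r (f x)) \<partial>lborel) = \<infinity>" "(\<integral>\<^sup>+x. ennreal (- phi r (f x)) \<partial>lborel) < \<infinity>"
  shows "renyi_entropy r f = \<infinity>"
proof -
  consider "r = 1" | "r < 1" | "r > 1" by linarith
  then show ?thesis
  proof cases
    case 1
    then show ?thesis using assms(2,3) unfolding renyi_entropy_phi(1)[OF f 1]
      by (cases "\<integral>\<^sup>+x. ennreal (- phi r (f x)) \<partial>lborel") auto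
  next
    case 2
    then show ?thesis using assms(2) unfolding renyi_entropy_phi(2)[OF f 2] by (simp add: ext_ln_def)
  qed (use assms nn_integral_phi_trivial(2)[of f r, OF f] in auto)
qed

lemma renyi_entropy_eq_minus_infinity:
  fixes f :: "'a::euclidean_space \<Rightarrow> real"
  assumes f: "\<And>x. 0 \<le> f x"
    and "(\<integral>\<^sup>+x. ennreal (phi r (f x)) \<partial>lborel) < \<infinity>" "(\<integral>\<^sup>+x. ennreal (- phi r (f x)) \<partial>lborel) = \<infinity>"
  shows "renyi_entropy r f = - \<infinity>"
proof -
  consider "r = 1" | "r < 1" | "r > 1" by linarith
  then show ?thesis
  proof cases
    case 1
    then show ?thesis using assms(2,3) unfolding renyi_entropy_phi(1)[OF f 1]
      by (cases "\<integral>\<^sup>+x. ennreal (phi r (f x)) \<partial>lborel") auto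
  next
    case 3
    then show ?thesis using assms(3) unfolding renyi_entropy_phi(3)[OF f 3]
      by (simp add: ext_ln_def divide_less_0_iff)
  qed (use assms nn_integral_phi_trivial(1)[of f r, OF f] in auto)
qed

lemma integrable_phi_iff:
  fixes f :: "'a::euclidean_space \<Rightarrow> real"
  assumes [measurable]: "f \<in> borel_measurable borel"
  shows "integrable lborel (\<lambda>x. phi r (f x)) \<longleftrightarrow>
    (\<integral>\<^sup>+x. ennreal (phi r (f x)) \<partial>lborel) < \<infinity> \<and> (\<integral>\<^sup>+x. ennreal (- phi r (f x)) \<partial>lborel) < \<infinity>"
  by (simp add: real_integrable_def less_top)

lemma renyi_entropy_less_infinityD:
  fixes f :: "'a::euclidean_space \<Rightarrow> real"
  assumes f: "\<And>x. 0 \<le> f x" and "renyi_entropy_defined r f" "renyi_entropy r f < \<infinity>"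
  shows "(\<integral>\<^sup>+x. ennreal (phi r (f x)) \<partial>lborel) < \<infinity>"
proof (rule ccontr)
  assume "\<not> ?thesis"
  then have inf: "(\<integral>\<^sup>+x. ennreal (phi r (f x)) \<partial>lborel) = \<infinity>"
    by (simp add: less_top[symmetric])
  with assms(2) have "(\<integral>\<^sup>+x. ennreal (- phi r (f x)) \<partial>lborel) < \<infinity>"
    using renyi_entropy_defined_iff[of f r, OF f] by simp
  from renyi_entropy_eq_infinity[of f r, OF f inf this] assms(3) show False by simp
qed

lemma renyi_entropy_eq_integral:
  assumes f: "prob_density f" and int: "integrable lborel (\<lambda>x. phi r (f x))"
  shows "renyi_entropy r f = ereal (if r = 1 then (\<integral>x. phi r (f x) \<partial>lborel) else ln \<bar>\<integral>x. phi r (f x) \<partial>lborel\<bar> / (1 - r))"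
    and "r < 1 \<Longrightarrow> 0 < (\<integral>x. phi r (f x) \<partial>lborel)" and "r > 1 \<Longrightarrow> (\<integral>x. phi r (f x) \<partial>lborel) < 0"
proof -
  note nn = prob_density_nonneg[OF f]
  let ?J = "\<integral>x. phi r (f x) \<partial>lborel"
  have J1: "r < 1 \<Longrightarrow> (\<integral>\<^sup>+x. ennreal (phi r (f x)) \<partial>lborel) = ennreal ?J"
    using int nn by (intro nn_integral_eq_integral) (auto simp: phi_nonneg)
  have J2: "r > 1 \<Longrightarrow> (\<integral>\<^sup>+x. ennreal (- phi r (f x)) \<partial>lborel) = ennreal (- ?J)"
    using int nn by (subst integral_minus[symmetric], intro nn_integral_eq_integral) (auto simp: phi_nonpos)
  show pos: "r < 1 \<Longrightarrow> 0 < ?J"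
    using J1 nn_integral_powr_nonzero[OF f, of r] nn by (auto simp: phi_neq_1 not_le ennreal_eq_0_iff intro: ccontr)
  show neg: "r > 1 \<Longrightarrow> ?J < 0"
    using J2 nn_integral_powr_nonzero[OF f, of r] nn by (auto simp: phi_neq_1 not_le ennreal_eq_0_iff intro: ccontr)
  consider "r = 1" | "r < 1" | "r > 1" by linarith
  then show "renyi_entropy r f = ereal (if r = 1 then ?J else ln \<bar>?J\<bar> / (1 - r))"
  proof cases
    case 1
    have fin: "(\<integral>\<^sup>+x. ennreal (phi r (f x)) \<partial>lborel) < \<infinity>" "(\<integral>\<^sup>+x. ennreal (- phi r (f x)) \<partial>lborel) < \<infinity>"
      using int by (auto simp: real_integrable_def less_top)
    then show ?thesis using 1 unfolding renyi_entropy_phi(1)[OF nn 1] real_lebesgue_integral_def[OF int]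
      by (cases "\<integral>\<^sup>+x. ennreal (phi r (f x)) \<partial>lborel"; cases "\<integral>\<^sup>+x. ennreal (- phi r (f x)) \<partial>lborel")
        (auto simp: enn2ereal_ennreal)
  next
    case 2
    then show ?thesis unfolding renyi_entropy_phi(2)[OF nn 2] J1[OF 2] using pos
      by (simp add: ext_ln_def ennreal_eq_0_iff)
  next
    case 3
    then show ?thesis unfolding renyi_entropy_phi(3)[OF nn 3] J2[OF 3] using neg
      by (simp add: ext_ln_def ennreal_eq_0_iff)
  qed
qed

text \<open>
  In terms of \<open>J = \<integral> phi r (f x) dx\<close> the entropy is \<open>J\<close> for \<open>r = 1\<close>, \<open>ln J / (1 - r)\<close> with \<open>J > 0\<close> for
  \<open>r < 1\<close>, and \<open>- ln (- J) / (r - 1)\<close> with \<open>J < 0\<close> for \<open>r > 1\<close>. All three increase strictly with \<open>J\<close>.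
\<close>
lemma renyi_entropy_le_iff:
  assumes f: "prob_density f" "integrable lborel (\<lambda>x. phi r (f x))"
    and g: "prob_density g" "integrable lborel (\<lambda>x. phi r (g x))"
  shows "renyi_entropy r g \<le> renyi_entropy r f \<longleftrightarrow> (\<integral>x. phi r (g x) \<partial>lborel) \<le> (\<integral>x. phi r (f x) \<partial>lborel)"
proof -
  consider "r = 1" | "r < 1" | "r > 1" by linarith
  then show ?thesis
    using renyi_entropy_eq_integral[OF f] renyi_entropy_eq_integral[OF g]
    by cases (auto simp: divide_le_cancel)
qed

section \<open>Concave densities maximise the entropy\<close>

lemma distributed_AE_transfer:
  assumes D: "distributed M lborel X h" and Q: "AE x in lborel. Q x"
  shows "AE w in M. Q (X w)"
proof -
  have "AE x in density lborel h. Q x"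
    using D Q by (subst AE_density) (auto simp: distributed_def elim!: eventually_mono)
  then have "AE x in distr M lborel X. Q x" using D by (simp only: distributed_def)
  then show ?thesis using D by (intro AE_distrD[of X M lborel]) (auto simp: distributed_def)
qed

lemma distributed_AE_iff:
  fixes h :: "'a::euclidean_space \<Rightarrow> real"
  assumes D: "distributed M lborel X (\<lambda>x. ennreal (h x))" and Q: "{x. Q x} \<in> sets borel"
  shows "(AE w in M. Q (X w)) \<longleftrightarrow> (AE x in lborel. 0 < h x \<longrightarrow> Q x)"
proof -
  have "(AE w in M. Q (X w)) \<longleftrightarrow> (AE x in distr M lborel X. Q x)"
    using D Q by (intro AE_distr_iff[symmetric]) (auto simp: distributed_def)
  also have "\<dots> \<longleftrightarrow> (AE x in density lborel (\<lambda>x. ennreal (h x)). Q x)"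
    using D by (simp only: distributed_def)
  also have "\<dots> \<longleftrightarrow> (AE x in lborel. 0 < h x \<longrightarrow> Q x)"
    using D by (subst AE_density) (auto simp: distributed_def)
  finally show ?thesis .
qed

lemma prob_density_level_set_pos:
  assumes f: "prob_density f"
  obtains c where "0 < c" "0 < emeasure lborel {x. c \<le> f x}"
proof -
  note [measurable] = prob_density_measurable[OF f]
  have "\<exists>k. 0 < emeasure lborel {x. 1 / real (Suc k) \<le> f x}"
  proof (rule ccontr)
    assume "\<not> ?thesis"
    then have "AE x in lborel. \<not> 1 / real (Suc k) \<le> f x" for k
      by (subst AE_iff_measurable[of "{x. 1 / real (Suc k) \<le> f x}"]) (auto simp: zero_less_iff_neq_zero)
    then have "AE x in lborel. \<forall>k. \<not> 1 / real (Suc k) \<le> f x" by (simp only: AE_all_countable) simp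
    then have "AE x in lborel. f x = 0"
    proof eventually_elim
      case (elim x)
      show ?case
      proof (rule ccontr)
        assume "f x \<noteq> 0"
        then have "0 < f x" using prob_density_nonneg[OF f, of x] by simp
        then obtain k where "1 / real (Suc k) < f x" using nat_approx_posE by blast
        with elim show False by (auto dest: spec[of _ k])
      qed
    qed
    then have "(\<integral>\<^sup>+x. ennreal (f x) \<partial>lborel) = (\<integral>\<^sup>+x. 0 \<partial>(lborel :: 'a measure))"
      by (intro nn_integral_cong_AE) (auto elim!: eventually_mono)
    then show False using nn_integral_prob_density[OF f] by simp
  qed
  then obtain k where "0 < emeasure lborel {x. 1 / real (Suc k) \<le> f x}" ..
  then show thesis by (intro that[of "1 / real (Suc k)"]) auto
qed

text \<open>
  On a set \<open>A\<close> of positive measure \<open>f\<close> is at least some \<open>c > 0\<close>. If \<open>f x\<close> were very large, then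
  concavity would make \<open>f\<close> at least \<open>B\<close> halfway between \<open>x\<close> and \<open>A\<close>, on a set whose measure does not
  depend on \<open>x\<close>; the constant \<open>B\<close> is chosen so that the mass there would exceed one.
\<close>
lemma s_concave_density_bounded:
  fixes f :: "'a::euclidean_space \<Rightarrow> real"
  assumes f: "prob_density f" and conc: "s_concave_density s f" and s: "0 \<le> s"
  obtains K where "0 < K" "AE x in lborel. f x \<le> K"
proof -
  note [measurable] = prob_density_measurable[OF f]
  obtain g where g: "s_concave s g" and fg: "AE x in lborel. f x = g x"
    using conc by (auto simp: s_concave_density_def)
  obtain N where N: "\<And>x. x \<notin> N \<Longrightarrow> f x = g x" "N \<in> null_sets lborel"
    using fg by (rule AE_E3) auto
  then have [measurable]: "N \<in> sets borel" by auto
  obtain c where c: "0 < c" "0 < emeasure lborel {x. c \<le> f x}"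
    using prob_density_level_set_pos[OF f] by blast
  define A where "A = {x. c \<le> f x} - N"
  have [measurable]: "A \<in> sets borel" by (simp add: A_def)
  have "0 < emeasure lborel A"
    using c(2) N(2) by (simp add: A_def emeasure_Diff_null_set)
  then obtain \<delta> where \<delta>: "0 < \<delta>" "ennreal \<delta> \<le> ennreal ((1 / \<bar>2\<bar>) ^ DIM('a)) * emeasure lborel A"
  proof -
    have "0 < ennreal ((1 / \<bar>2\<bar>) ^ DIM('a)) * emeasure lborel A"
      using \<open>0 < emeasure lborel A\<close> by (simp add: ennreal_zero_less_mult_iff)
    then obtain e where "0 < e" "e < ennreal ((1 / \<bar>2\<bar>) ^ DIM('a)) * emeasure lborel A"
      using dense by blast
    then show thesis using that[of "enn2real e"]
      by (cases e) (auto simp: less_imp_le)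
  qed
  define B where "B = 2 / \<delta>"
  have "B > 0" using \<delta> by (simp add: B_def)
  obtain K where K: "K > 0" "psi s K + psi s c \<le> 2 * psi s B"
  proof (cases "s = 0")
    case True
    show thesis
      by (rule that[of "B\<^sup>2 / c"])
        (use True \<open>B > 0\<close> c(1) in \<open>simp_all add: psi_def ln_div ln_realpow\<close>)
  next
    case False
    show thesis
      by (rule that[of "2 powr (1 / s) * B"])
        (use False s \<open>B > 0\<close> c(1) in \<open>simp_all add: psi_def powr_mult powr_powr\<close>)
  qed
  have "f x \<le> K" if "x \<notin> N" for x
  proof (rule ccontr)
    assume "\<not> f x \<le> K"
    then have x: "K < g x" using N(1)[OF that] by simp
    define D where "D = (\<lambda>z. - x + 2 *\<^sub>R z) -` A"
    have [measurable]: "D \<in> sets borel"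
      using measurable_sets[of "\<lambda>z. - x + 2 *\<^sub>R z" borel borel A] by (simp add: D_def)
    have "B \<le> g z" if "z \<in> D" for z
    proof -
      define y where "y = - x + 2 *\<^sub>R z"
      have y: "c \<le> g y" using that N(1)[of y] by (auto simp: D_def A_def y_def)
      have z: "z = (1 - 1/2) *\<^sub>R x + (1/2) *\<^sub>R y" by (simp add: y_def algebra_simps)
      have "0 < g z \<and> psi s (g z) \<le> (1 - 1/2) * psi s (g x) + (1/2) * psi s (g y)"
        unfolding z using x y K(1) c(1)
        by (intro g[unfolded s_concave_iff, THEN conjunct2, rule_format]) auto
      moreover have "psi s (g x) \<le> psi s K" "psi s (g y) \<le> psi s c"
        using x y K(1) c(1) by (auto intro: psi_antimono)
      ultimately have "0 < g z" "psi s (g z) \<le> psi s B" using K(2) by (auto simp: field_simps)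
      then show ?thesis using \<open>B > 0\<close> by (simp add: psi_le_iff)
    qed
    then have "AE z in lborel. ennreal B * indicator D z \<le> ennreal (f z)"
      using fg by (auto elim!: eventually_mono simp: indicator_def intro!: ennreal_leI)
    then have "(\<integral>\<^sup>+z. ennreal B * indicator D z \<partial>lborel) \<le> 1"
      unfolding nn_integral_prob_density[OF f, symmetric] by (rule nn_integral_mono_AE)
    then have "ennreal B * emeasure lborel D \<le> 1" by (simp add: nn_integral_cmult_indicator)
    moreover have "ennreal \<delta> \<le> emeasure lborel D"
      using \<delta>(2) unfolding D_def by (subst emeasure_lborel_affine_image) auto
    then have "ennreal B * ennreal \<delta> \<le> ennreal B * emeasure lborel D" by (rule mult_left_mono) simp
    ultimately have "ennreal B * ennreal \<delta> \<le> 1" by simp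
    moreover have "ennreal B * ennreal \<delta> = 2"
      using \<delta>(1) \<open>B > 0\<close> by (simp add: ennreal_mult'[symmetric] B_def)
    ultimately show False by simp
  qed
  then have "AE x in lborel. f x \<le> K" using AE_not_in[OF N(2)] by (auto elim!: eventually_mono)
  with K(1) show thesis by (rule that)
qed

lemma s_concave_density_psi_lower_bound:
  assumes f: "prob_density f" and conc: "s_concave_density s f"
  obtains b where "AE x in lborel. 0 < f x \<longrightarrow> b \<le> psi s (f x)"
proof (cases "0 \<le> s")
  case True
  obtain K where K: "0 < K" "AE x in lborel. f x \<le> K" using s_concave_density_bounded[OF f conc True] .
  show thesis
    by (rule that[of "psi s K"]) (use K in \<open>auto elim!: eventually_mono intro: psi_antimono\<close>)
next
  case False
  then show thesis by (intro that[of 0]) (simp add: psi_def)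
qed

text \<open>
  Since \<open>phi r u = u * psi (r - 1) u\<close>, a lower bound for \<open>psi\<close> turns into an integrable one for \<open>phi\<close>.
\<close>
lemma negative_part_phi_finite:
  assumes f: "prob_density f" and b: "AE x in lborel. 0 < f x \<longrightarrow> b \<le> psi (r - 1) (f x)"
  shows "(\<integral>\<^sup>+x. ennreal (- phi r (f x)) \<partial>lborel) < \<infinity>"
proof -
  have "(\<integral>\<^sup>+x. ennreal (- phi r (f x)) \<partial>lborel) \<le> (\<integral>\<^sup>+x. ennreal \<bar>b\<bar> * ennreal (f x) \<partial>lborel)"
  proof (rule nn_integral_mono_AE)
    show "AE x in lborel. ennreal (- phi r (f x)) \<le> ennreal \<bar>b\<bar> * ennreal (f x)"
      using b
    proof eventually_elim
      case (elim x)
      have "- phi r (f x) \<le> \<bar>b\<bar> * f x"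
      proof (cases "f x = 0")
        case False
        then have "0 < f x" using prob_density_nonneg[OF f, of x] by simp
        then have "f x * (- psi (r - 1) (f x)) \<le> f x * \<bar>b\<bar>" using elim by (intro mult_left_mono) auto
        then show ?thesis by (simp add: phi_def mult.commute)
      qed simp
      then show ?case using prob_density_nonneg[OF f, of x] by (simp add: ennreal_mult'[symmetric] ennreal_leI)
    qed
  qed
  also have "\<dots> = ennreal \<bar>b\<bar>"
    using prob_density_measurable[OF f] by (subst nn_integral_cmult) (auto simp: nn_integral_prob_density[OF f])
  also have "\<dots> < \<infinity>" by simp
  finally show ?thesis .
qed

lemma s_concave_density_negative_part:
  assumes f: "prob_density f" and conc: "s_concave_density (r - 1) f"
  shows "(\<integral>\<^sup>+x. ennreal (- phi r (f x)) \<partial>lborel) < \<infinity>"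
  using s_concave_density_psi_lower_bound[OF f conc] negative_part_phi_finite[OF f] by blast

text \<open>
  Jensen's inequality for the concave version \<open>g\<close> of \<open>f\<close>. It carries over to \<open>f\<close> because the vectors
  \<open>X i\<close> and their weighted sum all have densities and so avoid the null set where \<open>f\<close> and \<open>g\<close> differ.
\<close>
lemma coupling_sum_psi_le:
  fixes f :: "'a::euclidean_space \<Rightarrow> real"
  assumes f: "prob_density f" and conc: "s_concave_density s f" and P: "P \<in> couplings n f"
    and l: "\<And>i. i \<in> {1..n} \<Longrightarrow> 0 \<le> l i" "(\<Sum>i=1..n. l i) = 1"
    and D: "distributed P lborel (\<lambda>X. \<Sum>i=1..n. l i *\<^sub>R X i) w"
  shows "AE X in P. 0 < f (\<Sum>i=1..n. l i *\<^sub>R X i) \<and>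
    psi s (f (\<Sum>i=1..n. l i *\<^sub>R X i)) \<le> (\<Sum>i=1..n. l i * psi s (f (X i)))"
proof -
  note [measurable] = prob_density_measurable[OF f]
  obtain g where g: "s_concave s g" and fg: "AE x in lborel. f x = g x"
    using conc by (auto simp: s_concave_density_def)
  have D_i: "distributed P lborel (\<lambda>X. X i) (\<lambda>x. ennreal (f x))" if "i \<in> {1..n}" for i
    using P that by (simp add: couplings_def)
  have "{1..n} \<noteq> {}"
  proof
    assume "{1..n} = {}"
    with l(2) show False by (simp only: sum.empty)
  qed
  have "AE X in P. \<forall>i\<in>{1..n}. 0 < f (X i) \<and> f (X i) = g (X i)"
  proof (intro AE_finite_allI)
    fix i assume i: "i \<in> {1..n}"
    have "AE X in P. 0 < f (X i)" by (subst distributed_AE_iff[OF D_i[OF i]]) auto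
    moreover have "AE X in P. f (X i) = g (X i)" by (rule distributed_AE_transfer[OF D_i[OF i] fg])
    ultimately show "AE X in P. 0 < f (X i) \<and> f (X i) = g (X i)" by eventually_elim simp
  qed simp
  moreover have "AE X in P. f (\<Sum>i=1..n. l i *\<^sub>R X i) = g (\<Sum>i=1..n. l i *\<^sub>R X i)"
    by (rule distributed_AE_transfer[OF D fg])
  ultimately show ?thesis
  proof eventually_elim
    case (elim X)
    have conv: "convex_on {x. 0 < g x} (\<lambda>x. psi s (g x))" by (rule s_concave_imp_convex[OF g])
    have fX: "f (X i) = g (X i)" and gX: "0 < g (X i)" if "i \<in> {1..n}" for i
      using bspec[OF elim(1) that] by auto
    have "(\<Sum>i=1..n. l i *\<^sub>R X i) \<in> {x. 0 < g x}"
      using l gX conv by (intro convex_sum) (auto simp: convex_on_def)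
    moreover have "psi s (g (\<Sum>i=1..n. l i *\<^sub>R X i)) \<le> (\<Sum>i=1..n. l i * psi s (g (X i)))"
      using l gX \<open>{1..n} \<noteq> {}\<close> by (intro convex_on_sum[OF _ _ conv]) auto
    moreover have "(\<Sum>i=1..n. l i * psi s (f (X i))) = (\<Sum>i=1..n. l i * psi s (g (X i)))"
      by (intro sum.cong) (simp_all add: fX)
    ultimately show ?case using elim(2) by simp
  qed
qed

text \<open>
  Integrate the tangent inequality for \<open>phi r\<close> at \<open>f x\<close>, evaluated at \<open>w x\<close>. The linear term is
  \<open>r\<close> times the difference of the expectations of \<open>psi (r - 1) \<circ> f\<close> under \<open>w\<close> and under \<open>f\<close>, which is
  at most zero by \<open>coupling_sum_psi_le\<close>. Tangents exist almost everywhere where they are needed,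
  because \<open>w\<close> vanishes wherever \<open>f\<close> does.
\<close>
lemma entropy_coupling_sum_le:
  fixes f :: "'a::euclidean_space \<Rightarrow> real"
  assumes r: "0 < r" and f: "prob_density f" and conc: "s_concave_density (r - 1) f"
    and P: "P \<in> couplings n f"
    and l: "\<And>i. i \<in> {1..n} \<Longrightarrow> 0 \<le> l i" "(\<Sum>i=1..n. l i) = 1"
    and w: "prob_density w"
    and D: "distributed P lborel (\<lambda>X. \<Sum>i=1..n. l i *\<^sub>R X i) (\<lambda>x. ennreal (w x))"
  shows "renyi_entropy r w \<le> renyi_entropy r f"
proof (cases "(\<integral>\<^sup>+x. ennreal (phi r (f x)) \<partial>lborel) = \<infinity>")
  case True
  then show ?thesis
    using renyi_entropy_eq_infinity[of f r] prob_density_nonneg[OF f] s_concave_density_negative_part[OF f conc] by simp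
next
  case False
  note [measurable] = prob_density_measurable[OF f] prob_density_measurable[OF w]
  let ?psi = "psi (r - 1)" and ?Z = "\<lambda>X. \<Sum>i=1..n. l i *\<^sub>R X i"
  have int_f: "integrable lborel (\<lambda>x. phi r (f x))"
    using False s_concave_density_negative_part[OF f conc]
    by (simp add: integrable_phi_iff less_top)
  define J where "J = (\<integral>x. phi r (f x) \<partial>lborel)"
  interpret P: prob_space P using P by (simp add: couplings_def)
  have D_i: "distributed P lborel (\<lambda>X. X i) (\<lambda>x. ennreal (f x))" if "i \<in> {1..n}" for i
    using P that by (simp add: couplings_def)
  have int_i: "integrable P (\<lambda>X. ?psi (f (X i)))" and exp_i: "(\<integral>X. ?psi (f (X i)) \<partial>P) = J" if "i \<in> {1..n}" for i
    using distributed_integrable[OF D_i[OF that], of "\<lambda>x. ?psi (f x)"]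
      distributed_integral[OF D_i[OF that], of "\<lambda>x. ?psi (f x)"] int_f prob_density_nonneg[OF f]
    by (simp_all add: J_def phi_def)
  have Zle: "AE X in P. 0 < f (?Z X) \<and> ?psi (f (?Z X)) \<le> (\<Sum>i=1..n. l i * ?psi (f (X i)))"
    using coupling_sum_psi_le[OF f conc P l D] .
  obtain b where "AE x in lborel. 0 < f x \<longrightarrow> b \<le> ?psi (f x)"
    using s_concave_density_psi_lower_bound[OF f conc] .
  from distributed_AE_transfer[OF D this] have Zge: "AE X in P. 0 < f (?Z X) \<longrightarrow> b \<le> ?psi (f (?Z X))" .
  have meas_Z[measurable]: "?Z \<in> borel_measurable P" using D by (simp add: distributed_def)
  have int_sum: "integrable P (\<lambda>X. \<Sum>i=1..n. l i * ?psi (f (X i)))"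
    using int_i by (intro Bochner_Integration.integrable_sum) auto
  have int_Z: "integrable P (\<lambda>X. ?psi (f (?Z X)))"
  proof (rule Bochner_Integration.integrable_bound)
    show "integrable P (\<lambda>X. \<bar>b\<bar> + \<bar>\<Sum>i=1..n. l i * ?psi (f (X i))\<bar>)" using int_sum by auto
    show "AE X in P. norm (?psi (f (?Z X))) \<le> norm (\<bar>b\<bar> + \<bar>\<Sum>i=1..n. l i * ?psi (f (X i))\<bar>)"
      using Zle Zge by eventually_elim auto
  qed measurable
  have int_w: "integrable lborel (\<lambda>x. w x * ?psi (f x))"
    using distributed_integrable[OF D, of "\<lambda>x. ?psi (f x)"] int_Z prob_density_nonneg[OF w] by simp
  have "(\<integral>x. w x * ?psi (f x) \<partial>lborel) = (\<integral>X. ?psi (f (?Z X)) \<partial>P)"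
    using distributed_integral[OF D, of "\<lambda>x. ?psi (f x)"] prob_density_nonneg[OF w] by simp
  also have "\<dots> \<le> (\<integral>X. (\<Sum>i=1..n. l i * ?psi (f (X i))) \<partial>P)"
    using Zle by (intro integral_mono_AE int_Z int_sum) (auto elim!: eventually_mono)
  also have "\<dots> = (\<Sum>i=1..n. l i * J)"
    using int_i exp_i by (subst Bochner_Integration.integral_sum) auto
  also have "\<dots> = J" using l(2) by (simp flip: sum_distrib_right)
  finally have le_J: "(\<integral>x. w x * ?psi (f x) \<partial>lborel) \<le> J" .
  define e where "e = (if r = 1 then 1 else 0 :: real)"
  \<comment> \<open>The tangent, with \<open>f x * psi (r - 1) (f x)\<close> written as \<open>phi r (f x)\<close>.\<close>
  define R where "R x = phi r (f x) + (r * (w x * ?psi (f x)) - r * phi r (f x)) - e * (w x - f x)" for x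
  have int_R: "integrable lborel R"
    unfolding R_def using int_f int_w integrable_prob_density(1)[OF f] integrable_prob_density(1)[OF w] by auto
  have "(\<integral>x. R x \<partial>lborel) = J + (r * (\<integral>x. w x * ?psi (f x) \<partial>lborel) - r * J)"
    unfolding R_def J_def using int_f int_w integrable_prob_density[OF f] integrable_prob_density[OF w] by simp
  also have "\<dots> \<le> J" using le_J r by simp
  finally have R_le: "(\<integral>x. R x \<partial>lborel) \<le> J" .
  have "AE X in P. 0 < f (?Z X)" using Zle by eventually_elim simp
  then have "AE x in lborel. 0 < w x \<longrightarrow> 0 < f x"
    by (subst (asm) distributed_AE_iff[OF D]) auto
  then have phi_le_R: "AE x in lborel. phi r (w x) \<le> R x"
  proof eventually_elim
    case (elim x)
    show ?case
    proof (cases "0 < f x")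
      case True
      from phi_tangent[OF r True prob_density_nonneg[OF w], of x] show ?thesis
        by (simp add: R_def e_def phi_def algebra_simps)
    next
      case False
      then have "f x = 0" "w x = 0" using elim prob_density_nonneg[OF f, of x] prob_density_nonneg[OF w, of x] by auto
      then show ?thesis by (simp add: R_def)
    qed
  qed
  have pos_w: "(\<integral>\<^sup>+x. ennreal (phi r (w x)) \<partial>lborel) < \<infinity>"
  proof -
    have "(\<integral>\<^sup>+x. ennreal (phi r (w x)) \<partial>lborel) \<le> (\<integral>\<^sup>+x. ennreal (norm (R x)) \<partial>lborel)"
      using phi_le_R by (intro nn_integral_mono_AE) (auto elim!: eventually_mono intro!: ennreal_leI)
    also have "\<dots> < \<infinity>" using int_R by (simp add: integrable_iff_bounded)
    finally show ?thesis .
  qed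
  show ?thesis
  proof (cases "(\<integral>\<^sup>+x. ennreal (- phi r (w x)) \<partial>lborel) = \<infinity>")
    case True
    then show ?thesis
      using renyi_entropy_eq_minus_infinity[of w r] prob_density_nonneg[OF w] pos_w by simp
  next
    case False
    then have int: "integrable lborel (\<lambda>x. phi r (w x))"
      using pos_w by (simp add: integrable_phi_iff less_top)
    have "(\<integral>x. phi r (w x) \<partial>lborel) \<le> (\<integral>x. R x \<partial>lborel)"
      using phi_le_R by (intro integral_mono_AE int int_R)
    then show ?thesis using R_le by (simp add: renyi_entropy_le_iff[OF f int_f w int] J_def)
  qed
qed

lemma identity_coupling:
  fixes f :: "'a::euclidean_space \<Rightarrow> real"
  assumes f: "prob_density f" and l: "(\<Sum>i=1..n. l i) = 1"
  obtains P where "P \<in> couplings n f" "distributed P lborel (\<lambda>X. \<Sum>i=1..n. l i *\<^sub>R X i) (\<lambda>x. ennreal (f x))"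
proof -
  note [measurable] = prob_density_measurable[OF f]
  define c :: "'a \<Rightarrow> nat \<Rightarrow> 'a" where "c x = (\<lambda>i\<in>{1..n}. x)" for x
  let ?F = "density lborel (\<lambda>x. ennreal (f x))"
  have c: "c \<in> measurable ?F (\<Pi>\<^sub>M i\<in>{1..n}. borel)" unfolding c_def by measurable
  define P where "P = distr ?F (\<Pi>\<^sub>M i\<in>{1..n}. borel) c"
  have push: "distributed P lborel Y (\<lambda>x. ennreal (f x))" if "\<And>x. Y (c x) = x"
      "Y \<in> borel_measurable (\<Pi>\<^sub>M i\<in>{1..n}. borel)" for Y :: "(nat \<Rightarrow> 'a) \<Rightarrow> 'a"
  proof -
    have "distr P lborel Y = distr ?F lborel (\<lambda>x. x)"
      unfolding P_def using that c by (subst distr_distr) (auto simp: comp_def)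
    also have "\<dots> = ?F" by (rule distr_id2) simp
    finally show ?thesis using that by (simp add: distributed_def P_def)
  qed
  show thesis
  proof (rule that)
    show "P \<in> couplings n f"
      unfolding couplings_def
    proof (intro CollectI conjI ballI)
      interpret F: prob_space ?F
        by (rule prob_spaceI) (simp add: emeasure_density nn_integral_prob_density[OF f])
      show "prob_space P" unfolding P_def using c by (rule F.prob_space_distr)
      show "sets P = sets (\<Pi>\<^sub>M i\<in>{1..n}. borel)" by (simp add: P_def)
      show "distributed P lborel (\<lambda>X. X i) (\<lambda>x. ennreal (f x))" if "i \<in> {1..n}" for i
        using that by (intro push) (auto simp: c_def)
    qed
    show "distributed P lborel (\<lambda>X. \<Sum>i=1..n. l i *\<^sub>R X i) (\<lambda>x. ennreal (f x))"
    proof (rule push)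
      show "(\<Sum>i=1..n. l i *\<^sub>R c x i) = x" for x
        using l by (simp add: c_def flip: scaleR_sum_left)
    qed measurable
  qed
qed

theorem s_concave_imp_sup_sum_entropy_eq:
  fixes f :: "'a::euclidean_space \<Rightarrow> real"
  assumes r: "0 < r" and f: "prob_density f" and conc: "s_concave_density (r - 1) f"
    and l: "\<And>i. i \<in> {1..n} \<Longrightarrow> 0 \<le> l i" "(\<Sum>i=1..n. l i) = 1"
  shows "sup_sum_entropy r n f l = renyi_entropy r f"
  unfolding sup_sum_entropy_def
proof (rule antisym)
  show "Sup {h. \<exists>P\<in>couplings n f. has_renyi_entropy r P (\<lambda>X. \<Sum>i=1..n. l i *\<^sub>R X i) h} \<le> renyi_entropy r f"
    by (rule Sup_least) (auto simp: has_renyi_entropy_def intro: entropy_coupling_sum_le[OF r f conc _ l])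
  obtain P where "P \<in> couplings n f" "distributed P lborel (\<lambda>X. \<Sum>i=1..n. l i *\<^sub>R X i) (\<lambda>x. ennreal (f x))"
    using identity_coupling[OF f l(2)] .
  moreover have "renyi_entropy_defined r f"
    using renyi_entropy_defined_iff[of f r] prob_density_nonneg[OF f] s_concave_density_negative_part[OF f conc] by auto
  ultimately show "renyi_entropy r f \<le> Sup {h. \<exists>P\<in>couplings n f. has_renyi_entropy r P (\<lambda>X. \<Sum>i=1..n. l i *\<^sub>R X i) h}"
    using f by (intro Sup_upper) (auto simp: has_renyi_entropy_def)
qed

section \<open>Densities that maximise the entropy are concave\<close>

lemma entropy_le_sup_sum_entropy:
  assumes "P \<in> couplings n f" "distributed P lborel (\<lambda>X. \<Sum>i=1..n. l i *\<^sub>R X i) (\<lambda>x. ennreal (w x))"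
    and "prob_density w" "renyi_entropy_defined r w"
  shows "renyi_entropy r w \<le> sup_sum_entropy r n f l"
  unfolding sup_sum_entropy_def using assms by (intro Sup_upper) (auto simp: has_renyi_entropy_def)

text \<open>
  Split \<open>f = f1 + f2\<close> with \<open>f2\<close> bounded and carrying more than half of the mass. Pair the mass of \<open>f1\<close>
  independently with a part of \<open>f2\<close> of the same mass, in both orders, and leave the rest of \<open>f2\<close> on the
  diagonal. A convolution with a bounded density is bounded, and so is what remains on the diagonal.
\<close>
lemma bounded_midpoint_coupling:
  fixes f :: "'a::euclidean_space \<Rightarrow> real"
  assumes f: "prob_density f" and n: "n \<ge> 2"
  obtains w C P where "0 < C" "\<And>x. w x \<le> C" "prob_density w" "P \<in> couplings n f"
    "distributed P lborel (\<lambda>X. \<Sum>i=1..n. midpoint_weights i *\<^sub>R X i) (\<lambda>x. ennreal (w x))"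
proof -
  note [measurable] = prob_density_measurable[OF f]
  note nn = prob_density_nonneg[OF f]
  have "(\<lambda>k. \<integral>x. f x * indicator {x. f x \<le> real k} x \<partial>lborel) \<longlonglongrightarrow> (\<integral>x. f x \<partial>lborel)"
  proof (rule integral_dominated_convergence)
    show "integrable lborel f" by (rule integrable_prob_density(1)[OF f])
    show "AE x in lborel. (\<lambda>k. f x * indicator {x. f x \<le> real k} x) \<longlonglongrightarrow> f x"
    proof (rule AE_I2)
      fix x
      have "\<forall>\<^sub>F k in sequentially. f x * indicator {x. f x \<le> real k} x = f x"
        using eventually_ge_at_top[of "nat \<lceil>f x\<rceil>"]
        by eventually_elim (auto simp: indicator_def nat_le_iff ceiling_le_iff)
      then show "(\<lambda>k. f x * indicator {x. f x \<le> real k} x) \<longlonglongrightarrow> f x" by (rule tendsto_eventually)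
    qed
    show "AE x in lborel. norm (f x * indicator {x. f x \<le> real k} x) \<le> f x" for k
      using nn by (auto simp: indicator_def)
  qed measurable
  then have "(\<lambda>k. \<integral>x. f x * indicator {x. f x \<le> real k} x \<partial>lborel) \<longlonglongrightarrow> 1"
    by (simp add: integrable_prob_density(2)[OF f])
  then have "\<forall>\<^sub>F k in sequentially. 1 / 2 < (\<integral>x. f x * indicator {x. f x \<le> real k} x \<partial>lborel)"
    by (rule order_tendstoD(1)) simp
  then obtain k where k: "1 / 2 < (\<integral>x. f x * indicator {x. f x \<le> real k} x \<partial>lborel)"
    by (auto simp: eventually_sequentially)
  define f2 where "f2 x = f x * indicator {x. f x \<le> real k} x" for x
  define f1 where "f1 x = f x - f2 x" for x
  have [measurable]: "f1 \<in> borel_measurable borel" "f2 \<in> borel_measurable borel"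
    unfolding f1_def f2_def by measurable
  have f12: "0 \<le> f1 x" "0 \<le> f2 x" "f1 x \<le> f x" "f2 x \<le> f x" "f2 x \<le> real k" for x
    using nn[of x] by (auto simp: f1_def f2_def indicator_def)
  have int2: "integrable lborel f2"
    using f12 nn by (intro Bochner_Integration.integrable_bound[OF integrable_prob_density(1)[OF f]]) auto
  then have int1: "integrable lborel f1"
    unfolding f1_def using integrable_prob_density(1)[OF f] by simp
  define m where "m = (\<integral>x. f2 x \<partial>lborel)"
  have m1: "(\<integral>x. f1 x \<partial>lborel) = 1 - m"
    unfolding f1_def m_def using integrable_prob_density[OF f] int2 by simp
  have m: "1 / 2 < m" using k by (simp add: m_def f2_def)
  have "m \<le> 1" using m1 integral_nonneg_AE[of f1 lborel] f12 by simp
  have nn1: "(\<integral>\<^sup>+x. ennreal (f1 x) \<partial>lborel) = ennreal (1 - m)" and nn2: "(\<integral>\<^sup>+x. ennreal (f2 x) \<partial>lborel) = ennreal m"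
    using int1 int2 f12 by (simp_all add: nn_integral_eq_integral m1 flip: m_def)
  define c where "c = 1 / m"
  have "c > 0" using m by (simp add: c_def)
  define q where "q t = ennreal c * (ennreal (f1 (fst t)) * ennreal (f2 (snd t)) + ennreal (f2 (fst t)) * ennreal (f1 (snd t)))" for t
  have q[measurable]: "q \<in> borel_measurable (borel \<Otimes>\<^sub>M borel)" unfolding q_def by measurable
  \<comment> \<open>The part of \<open>f2\<close> with density \<open>((1 - m) / m) * f2\<close> has the mass \<open>1 - m\<close> of \<open>f1\<close> and is paired with it.\<close>
  define a where "a x = (1 - (1 - m) / m) * f2 x" for x
  have a[measurable]: "a \<in> borel_measurable borel" unfolding a_def by measurable
  have a_nonneg: "0 \<le> a x" for x
    unfolding a_def using m f12 by (intro mult_nonneg_nonneg) (auto simp: field_simps)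
  have a_le: "a x \<le> real k" for x
  proof -
    have "a x \<le> 1 * f2 x" unfolding a_def using m \<open>m \<le> 1\<close> f12 by (intro mult_right_mono) auto
    then show ?thesis using f12[of x] by simp
  qed
  have marg: "ennreal (a x) + (\<integral>\<^sup>+y. q (x, y) \<partial>lborel) = ennreal (f x)" for x
  proof -
    have "(\<integral>\<^sup>+y. q (x, y) \<partial>lborel) = ennreal c * (ennreal (f1 x) * ennreal m + ennreal (f2 x) * ennreal (1 - m))"
      by (simp add: q_def nn_integral_cmult nn_integral_add nn1 nn2)
    also have "\<dots> = ennreal (c * (f1 x * m + f2 x * (1 - m)))"
      using m \<open>m \<le> 1\<close> f12 \<open>c > 0\<close> by (simp add: ennreal_mult ennreal_plus)
    finally have "ennreal (a x) + (\<integral>\<^sup>+y. q (x, y) \<partial>lborel) = ennreal (a x + c * (f1 x * m + f2 x * (1 - m)))"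
      using m \<open>m \<le> 1\<close> f12 \<open>c > 0\<close> a_nonneg by (simp add: ennreal_plus)
    also have "a x + c * (f1 x * m + f2 x * (1 - m)) = f x"
      using m by (simp add: a_def c_def f1_def field_simps)
    finally show ?thesis .
  qed
  define I where "I z = (\<integral>\<^sup>+x. q (x, 2 *\<^sub>R z - x) \<partial>lborel)" for z
  have [measurable]: "I \<in> borel_measurable borel" unfolding I_def by measurable
  have I_le: "I z \<le> ennreal (c * real k * 2)" for z
  proof -
    have "I z \<le> (\<integral>\<^sup>+x. ennreal (c * real k) * (ennreal (f x) + ennreal (f (2 *\<^sub>R z - x))) \<partial>lborel)"
      unfolding I_def
    proof (rule nn_integral_mono)
      fix x
      have "f1 x * f2 y + f2 x * f1 y \<le> real k * (f x + f y)" for y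
      proof -
        have "f1 x * f2 y \<le> f x * real k" "f2 x * f1 y \<le> real k * f y"
          using f12[of x] f12[of y] nn by (auto intro!: mult_mono)
        then show ?thesis by (simp add: algebra_simps)
      qed
      then have "c * (f1 x * f2 y + f2 x * f1 y) \<le> c * (real k * (f x + f y))" for y
        using \<open>c > 0\<close> by (intro mult_left_mono) auto
      then show "q (x, 2 *\<^sub>R z - x) \<le> ennreal (c * real k) * (ennreal (f x) + ennreal (f (2 *\<^sub>R z - x)))"
        using f12 nn \<open>c > 0\<close>
        by (simp add: q_def ennreal_mult[symmetric] ennreal_plus[symmetric] mult.assoc ennreal_leI del: ennreal_plus)
    qed
    also have "\<dots> = ennreal (c * real k) * (1 + (\<integral>\<^sup>+x. ennreal (f (2 *\<^sub>R z + (-1) *\<^sub>R x)) \<partial>lborel))"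
      by (simp add: nn_integral_cmult nn_integral_add nn_integral_prob_density[OF f])
    also have "(\<integral>\<^sup>+x. ennreal (f (2 *\<^sub>R z + (-1) *\<^sub>R x)) \<partial>lborel) = 1"
      using nn_integral_lborel_affine[of "\<lambda>x. ennreal (f x)" "-1" "2 *\<^sub>R z"] nn_integral_prob_density[OF f] by simp
    also have "ennreal (c * real k) * (1 + 1) = ennreal (c * real k * 2)"
      using \<open>c > 0\<close> by (simp add: ennreal_mult)
    finally show ?thesis .
  qed
  define p where "p z = 2 ^ DIM('a) * enn2real (I z)" for z
  have p[measurable]: "p \<in> borel_measurable borel" unfolding p_def by measurable
  have p_eq: "ennreal (p z) = ennreal (2 ^ DIM('a)) * (\<integral>\<^sup>+x. q (x, 2 *\<^sub>R z - x) \<partial>lborel)" for z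
    unfolding I_def[symmetric] p_def using I_le[of z]
    by (simp add: ennreal_mult le_less_trans ennreal_enn2real_if)
       (metis ennreal_less_top linorder_not_le top.not_eq_extremum)
  have p_le: "p z \<le> 2 ^ DIM('a) * (c * real k * 2)" for z
    unfolding p_def using enn2real_mono[OF I_le[of z]] \<open>c > 0\<close> by (intro mult_left_mono) auto
  have p_nonneg: "0 \<le> p z" for z by (simp add: p_def)
  have sym: "q (x, y) = q (y, x)" for x y
    by (simp add: q_def algebra_simps)
  from midpoint_coupling[OF f n a a_nonneg q sym marg p p_nonneg p_eq]
  obtain P where "prob_density (\<lambda>z. a z + p z)" "P \<in> couplings n f"
     "distributed P lborel (\<lambda>X. \<Sum>i=1..n. midpoint_weights i *\<^sub>R X i) (\<lambda>z. ennreal (a z + p z))" by blast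
  moreover have "a z + p z \<le> real k + 2 ^ DIM('a) * (c * real k * 2) + 1" for z
    using a_le[of z] p_le[of z] by simp
  moreover have "0 < real k + 2 ^ DIM('a) * (c * real k * 2) + 1"
    using \<open>c > 0\<close> by (intro add_nonneg_pos add_nonneg_nonneg mult_nonneg_nonneg) auto
  ultimately show thesis
    by (intro that[where w = "\<lambda>z. a z + p z" and P = P and C = "real k + 2 ^ DIM('a) * (c * real k * 2) + 1"])
qed

text \<open>
  If the negative part were infinite, the entropy of \<open>f\<close> would be \<open>-\<infinity>\<close>, whereas a bounded density
  has an entropy above \<open>-\<infinity>\<close>.
\<close>
lemma integrable_phi_of_sup_eq:
  fixes f :: "'a::euclidean_space \<Rightarrow> real"
  assumes f: "prob_density f" and n: "n \<ge> 2"
    and fin: "renyi_entropy_defined r f" "renyi_entropy r f < \<infinity>"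
    and sup: "sup_sum_entropy r n f midpoint_weights \<le> renyi_entropy r f"
  shows "integrable lborel (\<lambda>x. phi r (f x))"
proof -
  note [measurable] = prob_density_measurable[OF f]
  have pos: "(\<integral>\<^sup>+x. ennreal (phi r (f x)) \<partial>lborel) < \<infinity>"
    by (rule renyi_entropy_less_infinityD[of f, OF prob_density_nonneg[OF f] fin])
  have "(\<integral>\<^sup>+x. ennreal (- phi r (f x)) \<partial>lborel) < \<infinity>"
  proof (rule ccontr)
    assume "\<not> ?thesis"
    then have minf: "renyi_entropy r f = - \<infinity>"
      using renyi_entropy_eq_minus_infinity[of f r] prob_density_nonneg[OF f] pos by (simp add: less_top[symmetric])
    obtain w C P where w: "0 < C" "\<And>x. w x \<le> C" "prob_density w" and P: "P \<in> couplings n f"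
      "distributed P lborel (\<lambda>X. \<Sum>i=1..n. midpoint_weights i *\<^sub>R X i) (\<lambda>x. ennreal (w x))"
      by (rule bounded_midpoint_coupling[OF f n]) (rule that)
    note [measurable] = prob_density_measurable[OF w(3)]
    have neg_w: "(\<integral>\<^sup>+x. ennreal (- phi r (w x)) \<partial>lborel) < \<infinity>"
      using w by (intro negative_part_phi_finite[of w "psi (r - 1) C"]) (auto intro: psi_antimono)
    then have "renyi_entropy_defined r w"
      using renyi_entropy_defined_iff[of w r] prob_density_nonneg[OF w(3)] by simp
    from entropy_le_sup_sum_entropy[OF P w(3) this] sup minf have "renyi_entropy r w = - \<infinity>" by simp
    moreover have "renyi_entropy r w \<noteq> - \<infinity>"
    proof (cases "(\<integral>\<^sup>+x. ennreal (phi r (w x)) \<partial>lborel) = \<infinity>")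
      case True
      then show ?thesis using renyi_entropy_eq_infinity[of w r] prob_density_nonneg[OF w(3)] neg_w by simp
    next
      case False
      then have "integrable lborel (\<lambda>x. phi r (w x))"
        using neg_w by (simp add: integrable_phi_iff less_top)
      from renyi_entropy_eq_integral(1)[OF w(3) this] show ?thesis by simp
    qed
    ultimately show False by simp
  qed
  with pos show ?thesis by (simp add: integrable_phi_iff)
qed

text \<open>
  Pairs at which the midpoint inequality fails with a margin \<open>\<eta>\<close> that survives changes of the values
  of \<open>f\<close> by \<open>\<eta>\<close>, in a region where all quantities are bounded in terms of \<open>\<eta>\<close> and \<open>R\<close>. The bound
  \<open>2 * \<eta>\<close> from below leaves \<open>f - \<eta>\<close> at least \<open>\<eta>\<close>.
\<close>
definition uniform_violations :: "real \<Rightarrow> ('a::euclidean_space \<Rightarrow> real) \<Rightarrow> real \<Rightarrow> real \<Rightarrow> ('a \<times> 'a) set" where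
  "uniform_violations s f \<eta> R = {t. norm (fst t) \<le> R \<and> norm (snd t) \<le> R \<and>
     2 * \<eta> \<le> f (fst t) \<and> f (fst t) \<le> R \<and> 2 * \<eta> \<le> f (snd t) \<and> f (snd t) \<le> R \<and>
     f (midpoint (fst t) (snd t)) \<le> R \<and>
     (psi s (f (fst t) - \<eta>) + psi s (f (snd t) - \<eta>)) / 2 + \<eta> \<le> psi s (f (midpoint (fst t) (snd t)) + \<eta>)}"

text \<open>
  Recouple the violating pairs \<open>B\<close>: take \<open>\<epsilon> m\<close> off the diagonal, where \<open>m\<close> is the marginal of the
  indicator of \<open>B\<close>, and distribute the pairs with density \<open>\<epsilon>\<close> on \<open>B\<close>, whose midpoints have density
  \<open>\<epsilon> p\<close>. The mean then has density \<open>w = f - \<epsilon> m + \<epsilon> p\<close>, and \<open>\<epsilon>\<close> is so small that \<open>w \<le> f + \<eta>\<close> where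
  \<open>p\<close> acts and \<open>w \<ge> f - \<eta>\<close> where \<open>m\<close> acts. The tangent of \<open>phi r\<close> at \<open>w\<close>, evaluated at \<open>f\<close>, bounds the
  gain of \<open>phi\<close> below by \<open>\<epsilon>\<close> times \<open>phi' (f + \<eta>) p - phi' (f - \<eta>) m\<close>, and the margin in the definition
  of \<open>B\<close> makes the integral of this at least \<open>r \<eta>\<close> times the measure of \<open>B\<close>. As the entropy of \<open>f\<close> is
  maximal, \<open>B\<close> is a null set.
\<close>
lemma uniform_violations_null:
  fixes f :: "'a::euclidean_space \<Rightarrow> real"
  assumes r: "0 < r" and f: "prob_density f" and n: "n \<ge> 2"
    and int_f: "integrable lborel (\<lambda>x. phi r (f x))"
    and sup: "sup_sum_entropy r n f midpoint_weights \<le> renyi_entropy r f"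
    and \<eta>: "0 < \<eta>" and R: "0 < R"
  shows "AE x in lborel. AE y in lborel. (x, y) \<notin> uniform_violations (r - 1) f \<eta> R"
proof -
  note [measurable] = prob_density_measurable[OF f]
  note nn = prob_density_nonneg[OF f]
  define B where "B = uniform_violations (r - 1) f \<eta> R"
  have [measurable]: "B \<in> sets (borel \<Otimes>\<^sub>M borel)"
  proof -
    have "{t \<in> space (borel \<Otimes>\<^sub>M borel). t \<in> B} \<in> sets (borel \<Otimes>\<^sub>M borel)"
      unfolding B_def uniform_violations_def mem_Collect_eq midpoint_def by measurable
    then show ?thesis by (simp add: space_pair_measure)
  qed
  have B_sym: "(x, y) \<in> B \<longleftrightarrow> (y, x) \<in> B" for x y
    by (auto simp: B_def uniform_violations_def midpoint_sym add.commute)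
  let ?psi = "psi (r - 1)" and ?D = "2 ^ DIM('a) :: real"
  define V where "V = measure lborel (cball (0 :: 'a) R)"
  have V: "emeasure lborel (cball (0 :: 'a) R) = ennreal V" "0 \<le> V"
    unfolding V_def using emeasure_bounded_finite[of "cball (0 :: 'a) R"]
    by (auto intro!: emeasure_eq_ennreal_measure)
  define m where "m x = enn2real (\<integral>\<^sup>+y. indicator B (x, y) \<partial>lborel)" for x
  define p where "p z = ?D * enn2real (\<integral>\<^sup>+x. indicator B (x, 2 *\<^sub>R z - x) \<partial>lborel)" for z
  have [measurable]: "m \<in> borel_measurable borel" "p \<in> borel_measurable borel"
    unfolding m_def p_def by measurable
  have m_bound: "(\<integral>\<^sup>+y. indicator B (x, y) \<partial>lborel) \<le> ennreal V" for x
  proof -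
    have "(\<integral>\<^sup>+y. indicator B (x, y) \<partial>lborel) \<le> (\<integral>\<^sup>+y. indicator (cball (0 :: 'a) R) y \<partial>lborel)"
      by (intro nn_integral_mono) (auto simp: B_def uniform_violations_def indicator_def)
    then show ?thesis by (simp add: V)
  qed
  have p_bound: "(\<integral>\<^sup>+x. indicator B (x, 2 *\<^sub>R z - x) \<partial>lborel) \<le> ennreal V" for z
  proof -
    have "(\<integral>\<^sup>+x. indicator B (x, 2 *\<^sub>R z - x) \<partial>lborel) \<le> (\<integral>\<^sup>+x. indicator (cball (0 :: 'a) R) x \<partial>lborel)"
      by (intro nn_integral_mono) (auto simp: B_def uniform_violations_def indicator_def)
    then show ?thesis by (simp add: V)
  qed
  have m_eq: "ennreal (m x) = (\<integral>\<^sup>+y. indicator B (x, y) \<partial>lborel)" for x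
    unfolding m_def using m_bound[of x] by (intro ennreal_enn2real) (simp add: le_less_trans)
  have p_eq: "ennreal (p z) = ennreal ?D * (\<integral>\<^sup>+x. indicator B (x, 2 *\<^sub>R z - x) \<partial>lborel)" for z
  proof -
    have "ennreal (enn2real (\<integral>\<^sup>+x. indicator B (x, 2 *\<^sub>R z - x) \<partial>lborel)) = (\<integral>\<^sup>+x. indicator B (x, 2 *\<^sub>R z - x) \<partial>lborel)"
      using p_bound[of z] by (intro ennreal_enn2real) (simp add: le_less_trans)
    then show ?thesis by (simp add: p_def ennreal_mult)
  qed
  have m_nonneg: "0 \<le> m x" and p_nonneg: "0 \<le> p x" for x by (simp_all add: m_def p_def)
  have m_le: "m x \<le> ?D * V" and p_le: "p x \<le> ?D * V" for x
  proof -
    have "m x \<le> V" unfolding m_def using enn2real_mono[OF m_bound[of x]] V by simp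
    also have "V = 1 * V" by simp
    also have "\<dots> \<le> ?D * V" by (rule mult_right_mono) (simp_all add: V)
    finally show "m x \<le> ?D * V" .
    show "p x \<le> ?D * V" unfolding p_def using enn2real_mono[OF p_bound[of x]] V
      by (intro mult_left_mono) auto
  qed
  have m_supp: "norm x \<le> R \<and> 2 * \<eta> \<le> f x \<and> f x \<le> R" if "m x \<noteq> 0" for x
  proof (rule ccontr)
    assume "\<not> ?thesis"
    then have "(x, y) \<notin> B" for y by (auto simp: B_def uniform_violations_def)
    then have "m x = 0" by (simp add: m_def)
    with that show False by simp
  qed
  have p_supp: "norm z \<le> R \<and> f z \<le> R" if "p z \<noteq> 0" for z
  proof (rule ccontr)
    assume *: "\<not> ?thesis"
    have "(x, 2 *\<^sub>R z - x) \<notin> B" for x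
    proof
      assume B: "(x, 2 *\<^sub>R z - x) \<in> B"
      have mid: "midpoint x (2 *\<^sub>R z - x) = z" by (simp add: midpoint_def)
      have "norm (2 *\<^sub>R z) \<le> norm x + norm (2 *\<^sub>R z - x)" by norm
      then have "norm z \<le> R" using B by (auto simp: B_def uniform_violations_def)
      with B * mid show False by (auto simp: B_def uniform_violations_def)
    qed
    then have "p z = 0" by (simp add: p_def)
    with that show False by simp
  qed
  define \<epsilon> where "\<epsilon> = \<eta> / (?D * V + 1)"
  have DV: "0 < ?D * V + 1" using V by (simp add: add_nonneg_pos)
  have \<epsilon>: "0 < \<epsilon>" using \<eta> DV by (simp add: \<epsilon>_def)
  have \<epsilon>_mult: "\<epsilon> * t \<le> \<eta>" if "t \<le> ?D * V" for t
  proof -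
    have "\<epsilon> * t \<le> \<epsilon> * (?D * V + 1)" using that \<epsilon> by (intro mult_left_mono) auto
    also have "\<dots> = \<eta>" using DV by (simp add: \<epsilon>_def)
    finally show ?thesis .
  qed
  define a where "a x = f x - \<epsilon> * m x" for x
  define w where "w x = a x + \<epsilon> * p x" for x
  have [measurable]: "a \<in> borel_measurable borel" "w \<in> borel_measurable borel" unfolding w_def a_def by measurable
  have a_lower: "f x - \<eta> \<le> a x" "m x \<noteq> 0 \<Longrightarrow> \<eta> \<le> a x" and a_nonneg: "0 \<le> a x" for x
    using \<epsilon>_mult[OF m_le[of x]] m_supp[of x] nn[of x] \<eta> by (cases "m x = 0"; simp add: a_def)+
  have w_upper: "w x \<le> f x + \<eta>" for x
  proof -
    have "0 \<le> \<epsilon> * m x" using \<epsilon> m_nonneg[of x] by simp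
    then show ?thesis using \<epsilon>_mult[OF p_le[of x]] by (simp add: w_def a_def)
  qed
  have w_ge_a: "a x \<le> w x" for x using \<epsilon> p_nonneg[of x] by (simp add: w_def)
  have w_nonneg: "0 \<le> w x" for x using w_ge_a a_nonneg order_trans by blast
  define q where "q t = ennreal \<epsilon> * indicator B t" for t
  have q: "q \<in> borel_measurable (borel \<Otimes>\<^sub>M borel)" unfolding q_def by measurable
  have marg: "ennreal (a x) + (\<integral>\<^sup>+y. q (x, y) \<partial>lborel) = ennreal (f x)" for x
  proof -
    have "(\<integral>\<^sup>+y. q (x, y) \<partial>lborel) = ennreal (\<epsilon> * m x)"
      using \<epsilon> m_nonneg by (simp add: q_def nn_integral_cmult m_eq ennreal_mult)
    then show ?thesis using \<epsilon> m_nonneg a_nonneg[of x] by (simp add: ennreal_plus[symmetric] a_def del: ennreal_plus)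
  qed
  have sym: "q (x, y) = q (y, x)" for x y using B_sym[of x y] by (simp add: q_def indicator_def)
  have "ennreal (\<epsilon> * p z) = ennreal ?D * (\<integral>\<^sup>+x. q (x, 2 *\<^sub>R z - x) \<partial>lborel)" for z
    using \<epsilon> p_nonneg by (simp add: q_def nn_integral_cmult p_eq ennreal_mult mult.left_commute)
  from midpoint_coupling[OF f n _ a_nonneg q sym marg _ _ this] \<epsilon> p_nonneg
  obtain P where w: "prob_density w" and P: "P \<in> couplings n f"
     "distributed P lborel (\<lambda>X. \<Sum>i=1..n. midpoint_weights i *\<^sub>R X i) (\<lambda>z. ennreal (w z))"
    by (auto simp flip: w_def)

  \<comment> \<open>Subtracting a lower bound \<open>\<kappa>\<close> of the values of \<open>psi\<close> that occur makes the integrands nonnegative. This does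
    not affect the gain, because \<open>p\<close> and \<open>m\<close> have the same mass.\<close>
  define \<kappa> where "\<kappa> = ?psi (R + \<eta>)"
  define U where "U = ?psi \<eta> - \<kappa>"
  define u where "u z = ?psi (f z + \<eta>) - \<kappa>" for z
  define v where "v z = ?psi (f z - \<eta>) - \<kappa>" for z
  have [measurable]: "u \<in> borel_measurable borel" "v \<in> borel_measurable borel" unfolding u_def v_def by measurable
  have "0 \<le> U" using psi_antimono[of \<eta> "R + \<eta>" "r - 1"] \<eta> R by (simp add: U_def \<kappa>_def)
  have u: "0 \<le> u z" "u z \<le> U" if "f z \<le> R" for z
    using psi_antimono[of "f z + \<eta>" "R + \<eta>" "r - 1"] psi_antimono[of \<eta> "f z + \<eta>" "r - 1"] that \<eta> nn[of z]
    by (simp_all add: u_def U_def \<kappa>_def add_nonneg_pos)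
  have v: "0 \<le> v z" "v z \<le> U" if "2 * \<eta> \<le> f z" "f z \<le> R" for z
    using psi_antimono[of "f z - \<eta>" "R + \<eta>" "r - 1"] psi_antimono[of \<eta> "f z - \<eta>" "r - 1"] that \<eta>
    by (simp_all add: v_def U_def \<kappa>_def)
  have int_ball: "integrable lborel (\<lambda>x. C * indicator (cball (0 :: 'a) R) x :: real)" for C
    by (intro integrable_mult_right integrable_real_indicator) (auto simp: V)
  have p_ind: "norm (p x) \<le> norm (?D * V * indicator (cball (0 :: 'a) R) x)" for x
    using p_supp[of x] p_le[of x] p_nonneg[of x] V by (cases "p x = 0") auto
  have m_ind: "norm (m x) \<le> norm (?D * V * indicator (cball (0 :: 'a) R) x)" for x
    using m_supp[of x] m_le[of x] m_nonneg[of x] V by (cases "m x = 0") auto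
  have int_p: "integrable lborel p"
    by (rule Bochner_Integration.integrable_bound[OF int_ball[of "?D * V"]]) (use p_ind in auto)
  have int_m: "integrable lborel m"
    by (rule Bochner_Integration.integrable_bound[OF int_ball[of "?D * V"]]) (use m_ind in auto)
  have up_bound: "0 \<le> u z * p z" "u z * p z \<le> U * p z" for z
    using u[of z] p_supp[of z] p_nonneg[of z] by (cases "p z = 0"; simp add: mult_right_mono)+
  have vm_bound: "0 \<le> v z * m z" "v z * m z \<le> U * m z" for z
    using v[of z] m_supp[of z] m_nonneg[of z] by (cases "m z = 0"; simp add: mult_right_mono)+
  have up_norm: "norm (u z * p z) \<le> norm (U * p z)" for z
    using up_bound[of z] unfolding real_norm_def by linarith
  have vm_norm: "norm (v z * m z) \<le> norm (U * m z)" for z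
    using vm_bound[of z] unfolding real_norm_def by linarith
  have int_up: "integrable lborel (\<lambda>z. u z * p z)"
    by (rule Bochner_Integration.integrable_bound[of _ "\<lambda>z. U * p z"]) (use int_p up_norm in auto)
  have int_vm: "integrable lborel (\<lambda>z. v z * m z)"
    by (rule Bochner_Integration.integrable_bound[of _ "\<lambda>z. U * m z"]) (use int_m vm_norm in auto)
  define \<mu> where "\<mu> = (\<integral>x. m x \<partial>lborel)"
  have m_mass: "ennreal \<mu> = (\<integral>\<^sup>+x. \<integral>\<^sup>+y. indicator B (x, y) \<partial>lborel \<partial>lborel)"
    using nn_integral_eq_integral[OF int_m] m_nonneg by (simp add: \<mu>_def m_eq)
  have nn_p: "(\<integral>\<^sup>+z. ennreal (p z) * h z \<partial>lborel) = (\<integral>\<^sup>+x. \<integral>\<^sup>+y. indicator B (x, y) * h (midpoint x y) \<partial>lborel \<partial>lborel)"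
    if [measurable]: "h \<in> borel_measurable borel" for h
    unfolding p_eq by (rule nn_integral_midpoint[symmetric]) measurable
  have p_mass: "(\<integral>x. p x \<partial>lborel) = \<mu>"
  proof -
    have "ennreal (\<integral>x. p x \<partial>lborel) = (\<integral>\<^sup>+z. ennreal (p z) * 1 \<partial>lborel)"
      using nn_integral_eq_integral[OF int_p] p_nonneg by simp
    also have "\<dots> = ennreal \<mu>" by (subst nn_p) (simp_all add: m_mass)
    finally show ?thesis
      using p_nonneg m_nonneg by (subst (asm) ennreal_inj) (auto simp: \<mu>_def intro!: integral_nonneg_AE)
  qed
  have "\<mu> \<ge> 0" unfolding \<mu>_def using m_nonneg by (intro integral_nonneg_AE) auto
  have gain: "\<eta> * \<mu> \<le> (\<integral>z. u z * p z \<partial>lborel) - (\<integral>z. v z * m z \<partial>lborel)"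
  proof -
    let ?A = "\<integral>z. u z * p z \<partial>lborel" and ?C = "\<integral>z. v z * m z \<partial>lborel"
    have "0 \<le> ?A" "0 \<le> ?C" using up_bound vm_bound by (auto intro!: integral_nonneg_AE)
    have A: "ennreal ?A = (\<integral>\<^sup>+x. \<integral>\<^sup>+y. indicator B (x, y) * ennreal (u (midpoint x y)) \<partial>lborel \<partial>lborel)"
    proof -
      have "ennreal ?A = (\<integral>\<^sup>+z. ennreal (u z * p z) \<partial>lborel)"
        using nn_integral_eq_integral[OF int_up] up_bound by simp
      also have "\<dots> = (\<integral>\<^sup>+z. ennreal (p z) * ennreal (u z) \<partial>lborel)"
        using p_nonneg by (simp add: ennreal_mult'[symmetric] mult.commute)
      finally show ?thesis by (simp add: nn_p)
    qed
    have C: "ennreal ?C = (\<integral>\<^sup>+x. \<integral>\<^sup>+y. indicator B (x, y) * ennreal (v x) \<partial>lborel \<partial>lborel)"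
    proof -
      have "ennreal ?C = (\<integral>\<^sup>+z. ennreal (v z * m z) \<partial>lborel)"
        using nn_integral_eq_integral[OF int_vm] vm_bound by simp
      also have "\<dots> = (\<integral>\<^sup>+z. ennreal (m z) * ennreal (v z) \<partial>lborel)"
        using m_nonneg by (simp add: ennreal_mult'[symmetric] mult.commute)
      finally show ?thesis by (simp add: m_eq nn_integral_multc)
    qed
    have C': "ennreal ?C = (\<integral>\<^sup>+x. \<integral>\<^sup>+y. indicator B (x, y) * ennreal (v y) \<partial>lborel \<partial>lborel)"
    proof -
      have "ennreal ?C = (\<integral>\<^sup>+y. \<integral>\<^sup>+x. indicator B (x, y) * ennreal (v x) \<partial>lborel \<partial>lborel)"
        unfolding C by (rule lborel_pair.Fubini') measurable
      then show ?thesis using B_sym by (simp add: indicator_def)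
    qed
    have "(\<integral>\<^sup>+x. \<integral>\<^sup>+y. indicator B (x, y) * ennreal (v x) + indicator B (x, y) * ennreal (v y) + ennreal (2 * \<eta>) * indicator B (x, y) \<partial>lborel \<partial>lborel)
        \<le> (\<integral>\<^sup>+x. \<integral>\<^sup>+y. 2 * (indicator B (x, y) * ennreal (u (midpoint x y))) \<partial>lborel \<partial>lborel)"
    proof (intro nn_integral_mono)
      fix x y :: 'a
      show "indicator B (x, y) * ennreal (v x) + indicator B (x, y) * ennreal (v y) + ennreal (2 * \<eta>) * indicator B (x, y)
          \<le> 2 * (indicator B (x, y) * ennreal (u (midpoint x y)))"
      proof (cases "(x, y) \<in> B")
        case True
        then have B: "2 * \<eta> \<le> f x" "f x \<le> R" "2 * \<eta> \<le> f y" "f y \<le> R" "f (midpoint x y) \<le> R"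
          "v x + v y + 2 * \<eta> \<le> 2 * u (midpoint x y)"
          by (simp_all add: B_def uniform_violations_def u_def v_def field_simps)
        then have "ennreal (v x + v y + 2 * \<eta>) \<le> ennreal (2 * u (midpoint x y))" by (intro ennreal_leI)
        then show ?thesis using True B v u \<eta> by (simp add: ennreal_plus ennreal_mult)
      qed simp
    qed
    also have "\<dots> = 2 * ennreal ?A"
      unfolding A by (simp add: midpoint_def nn_integral_cmult)
    also have "(\<integral>\<^sup>+x. \<integral>\<^sup>+y. indicator B (x, y) * ennreal (v x) + indicator B (x, y) * ennreal (v y) + ennreal (2 * \<eta>) * indicator B (x, y) \<partial>lborel \<partial>lborel)
        = ennreal ?C + ennreal ?C + ennreal (2 * \<eta>) * ennreal \<mu>"
      by (subst (1) C, subst C', subst m_mass) (simp add: nn_integral_add nn_integral_cmult)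
    finally have "ennreal ?C + ennreal ?C + ennreal (2 * \<eta>) * ennreal \<mu> \<le> 2 * ennreal ?A" .
    moreover have "ennreal ?C + ennreal ?C + ennreal (2 * \<eta>) * ennreal \<mu> = ennreal (?C + ?C + 2 * \<eta> * \<mu>)"
    proof -
      have "ennreal (2 * \<eta>) * ennreal \<mu> = ennreal (2 * \<eta> * \<mu>)"
        using \<eta> by (intro ennreal_mult'[symmetric]) simp
      moreover have "0 \<le> 2 * \<eta> * \<mu>" using \<eta> \<open>\<mu> \<ge> 0\<close> by simp
      moreover have "0 \<le> ?C + ?C" using \<open>0 \<le> ?C\<close> by simp
      ultimately show ?thesis using \<open>0 \<le> ?C\<close> by (simp only: ennreal_plus)
    qed
    moreover have "2 * ennreal ?A = ennreal (2 * ?A)"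
      using \<open>0 \<le> ?A\<close> by (simp add: ennreal_mult)
    ultimately have "ennreal (?C + ?C + 2 * \<eta> * \<mu>) \<le> ennreal (2 * ?A)" by (simp only:)
    then have "?C + ?C + 2 * \<eta> * \<mu> \<le> 2 * ?A"
      using \<open>0 \<le> ?A\<close> by (subst (asm) ennreal_le_iff) auto
    then show ?thesis by simp
  qed

  define e where "e = (if r = 1 then 1 else 0 :: real)"
  \<comment> \<open>Equal to \<open>phi' (f + \<eta>) * p - phi' (f - \<eta>) * m\<close>.\<close>
  define \<Delta> where "\<Delta> z = r * (u z * p z - v z * m z) + (r * \<kappa> - e) * (p z - m z)" for z
  have int_\<Delta>: "integrable lborel \<Delta>"
    unfolding \<Delta>_def using int_up int_vm int_p int_m by auto
  have \<Delta>_ge: "r * (\<eta> * \<mu>) \<le> (\<integral>z. \<Delta> z \<partial>lborel)"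
  proof -
    have "(\<integral>z. \<Delta> z \<partial>lborel) = r * ((\<integral>z. u z * p z \<partial>lborel) - (\<integral>z. v z * m z \<partial>lborel))"
      unfolding \<Delta>_def using int_up int_vm int_p int_m p_mass by (simp add: \<mu>_def)
    then show ?thesis using gain r by simp
  qed
  have lower: "phi r (f z) + \<epsilon> * \<Delta> z \<le> phi r (w z)" for z
  proof (cases "w z = 0")
    case True
    then have "a z = 0" "\<epsilon> * p z = 0"
      using w_ge_a[of z] a_nonneg[of z] by (auto simp: w_def)
    then have "p z = 0" "m z = 0" using a_lower(2)[of z] \<eta> \<epsilon> by auto
    then show ?thesis using True \<open>a z = 0\<close> by (simp add: \<Delta>_def a_def)
  next
    case False
    then have "0 < w z" using w_nonneg[of z] by simp
    have "phi r (f z) \<le> phi r (w z) + (r * ?psi (w z) - e) * (f z - w z)"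
      using phi_tangent[OF r \<open>0 < w z\<close> nn[of z]] by (simp add: e_def)
    also have "f z - w z = - (\<epsilon> * (p z - m z))" by (simp add: w_def a_def algebra_simps)
    finally have 1: "phi r (f z) + \<epsilon> * ((r * ?psi (w z) - e) * (p z - m z)) \<le> phi r (w z)"
      by (simp add: algebra_simps)
    have "u z * p z \<le> (?psi (w z) - \<kappa>) * p z"
      using psi_antimono[OF \<open>0 < w z\<close> w_upper[of z]] p_nonneg[of z] by (intro mult_right_mono) (auto simp: u_def)
    moreover have "(?psi (w z) - \<kappa>) * m z \<le> v z * m z"
    proof (cases "m z = 0")
      case False
      then have "0 < f z - \<eta>" using m_supp[of z] \<eta> by auto
      moreover have "f z - \<eta> \<le> w z" using a_lower(1)[of z] w_ge_a[of z] by simp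
      ultimately show ?thesis
        using psi_antimono[of "f z - \<eta>" "w z" "r - 1"] m_nonneg[of z] by (intro mult_right_mono) (auto simp: v_def)
    qed simp
    ultimately have "r * (u z * p z - v z * m z) \<le> r * ((?psi (w z) - \<kappa>) * p z - (?psi (w z) - \<kappa>) * m z)"
      using r by (intro mult_left_mono) auto
    then have "\<Delta> z \<le> (r * ?psi (w z) - e) * (p z - m z)"
      by (simp add: \<Delta>_def algebra_simps)
    then have "\<epsilon> * \<Delta> z \<le> \<epsilon> * ((r * ?psi (w z) - e) * (p z - m z))" using \<epsilon> by (intro mult_left_mono) auto
    with 1 show ?thesis by linarith
  qed
  have upper: "phi r (w z) \<le> \<bar>phi r (f z)\<bar> + (1 + w z) * indicator (cball (0 :: 'a) R) z" for z
  proof (cases "norm z \<le> R")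
    case True
    then show ?thesis using phi_le[OF r w_nonneg[of z]] by simp
  next
    case False
    then have "m z = 0" "p z = 0" using m_supp[of z] p_supp[of z] by auto
    then have "w z = f z" by (simp add: w_def a_def)
    then show ?thesis using False by simp
  qed
  have int_w: "integrable lborel (\<lambda>z. phi r (w z))"
  proof (rule Bochner_Integration.integrable_bound)
    show "integrable lborel (\<lambda>z. \<bar>phi r (f z)\<bar> + \<epsilon> * \<bar>\<Delta> z\<bar> + (1 * indicator (cball (0 :: 'a) R) z + w z))"
      using int_f int_\<Delta> int_ball[of 1] integrable_prob_density(1)[OF w] by auto
    show "AE z in lborel. norm (phi r (w z)) \<le> norm (\<bar>phi r (f z)\<bar> + \<epsilon> * \<bar>\<Delta> z\<bar> + (1 * indicator (cball (0 :: 'a) R) z + w z))"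
    proof (rule AE_I2)
      fix z
      have "(1 + w z) * indicator (cball (0 :: 'a) R) z \<le> 1 * indicator (cball (0 :: 'a) R) z + w z"
        using w_nonneg[of z] by (auto simp: indicator_def)
      moreover have "\<bar>\<epsilon> * \<Delta> z\<bar> = \<epsilon> * \<bar>\<Delta> z\<bar>" using \<epsilon> by (simp add: abs_mult)
      moreover have "0 \<le> 1 * indicator (cball (0 :: 'a) R) z + w z" using w_nonneg[of z] by simp
      ultimately have "\<bar>phi r (w z)\<bar> \<le> \<bar>phi r (f z)\<bar> + \<epsilon> * \<bar>\<Delta> z\<bar> + (1 * indicator (cball (0 :: 'a) R) z + w z)"
        using lower[of z] upper[of z] by linarith
      then show "norm (phi r (w z)) \<le> norm (\<bar>phi r (f z)\<bar> + \<epsilon> * \<bar>\<Delta> z\<bar> + (1 * indicator (cball (0 :: 'a) R) z + w z))"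
        by simp
    qed
  qed measurable
  have "renyi_entropy_defined r w"
    using int_w renyi_entropy_defined_iff[of w r, OF w_nonneg] by (simp add: integrable_phi_iff)
  then have "renyi_entropy r w \<le> renyi_entropy r f"
    using entropy_le_sup_sum_entropy[OF P w] sup by (meson order_trans)
  then have "(\<integral>z. phi r (w z) \<partial>lborel) \<le> (\<integral>z. phi r (f z) \<partial>lborel)"
    by (simp add: renyi_entropy_le_iff[OF f int_f w int_w])
  moreover have "(\<integral>z. phi r (f z) \<partial>lborel) + \<epsilon> * (\<integral>z. \<Delta> z \<partial>lborel) \<le> (\<integral>z. phi r (w z) \<partial>lborel)"
  proof -
    have "(\<integral>z. phi r (f z) + \<epsilon> * \<Delta> z \<partial>lborel) \<le> (\<integral>z. phi r (w z) \<partial>lborel)"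
      using int_f int_\<Delta> int_w lower by (intro integral_mono) auto
    then show ?thesis using int_f int_\<Delta> by simp
  qed
  ultimately have "\<epsilon> * (\<integral>z. \<Delta> z \<partial>lborel) \<le> 0" by linarith
  then have "(\<integral>z. \<Delta> z \<partial>lborel) \<le> 0" using \<epsilon> by (simp add: mult_le_0_iff)
  then have "r * (\<eta> * \<mu>) \<le> 0" using \<Delta>_ge by linarith
  then have "\<mu> = 0" using r \<eta> \<open>\<mu> \<ge> 0\<close> by (simp add: mult_le_0_iff)
  then have "(\<integral>\<^sup>+x. \<integral>\<^sup>+y. indicator B (x, y) \<partial>lborel \<partial>lborel) = 0" using m_mass by simp
  then have "AE x in lborel. (\<integral>\<^sup>+y. indicator B (x, y) \<partial>lborel) = 0"
    by (subst (asm) nn_integral_0_iff_AE) auto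
  then show ?thesis
  proof eventually_elim
    case (elim x)
    then have "AE y in lborel. indicator B (x, y) = (0 :: ennreal)"
      by (subst (asm) nn_integral_0_iff_AE) auto
    then show ?case unfolding B_def[symmetric] by eventually_elim (auto simp: indicator_def split: if_splits)
  qed
qed

lemma isCont_psi: "0 < a \<Longrightarrow> isCont (psi s) a"
proof -
  assume "0 < a"
  then have "isCont (\<lambda>a. if s = 0 then - ln a else - sgn s * a powr s) a"
    by (cases "s = 0") (auto intro!: continuous_intros)
  then show ?thesis by (simp add: psi_def[abs_def])
qed

text \<open>
  By continuity a strict failure keeps a margin if \<open>f\<close> is positive at the midpoint. If it vanishes
  there, \<open>psi s\<close> near \<open>0\<close> is close to its supremum, which lies above the average of the two values.
  In both cases there is a level \<open>b\<close> above the value at the midpoint at which \<open>psi s\<close> still exceeds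
  the average.
\<close>
lemma midpoint_failure_imp_uniform_violation:
  fixes f :: "'a::euclidean_space \<Rightarrow> real"
  assumes nn: "\<And>z. 0 \<le> f z" and pos: "0 < f x" "0 < f y"
    and fails: "\<not> (0 < f (midpoint x y) \<and> psi s (f (midpoint x y)) \<le> (psi s (f x) + psi s (f y)) / 2)"
  shows "\<exists>k. (x, y) \<in> uniform_violations s f (1 / real (Suc k)) (real (Suc k))"
proof -
  define z where "z = midpoint x y"
  define A where "A = (psi s (f x) + psi s (f y)) / 2"
  have psi_sign: "0 < s \<Longrightarrow> 0 < b \<Longrightarrow> psi s b < 0" "s < 0 \<Longrightarrow> 0 < b \<Longrightarrow> 0 < psi s b" for b
    by (simp_all add: psi_def)
  obtain T where T: "A < T" "0 < f z \<Longrightarrow> T < psi s (f z)" "0 < s \<Longrightarrow> T < 0"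
  proof (cases "0 < f z")
    case True
    then have "A < psi s (f z)" using fails by (simp add: A_def z_def)
    then show thesis
      using psi_sign(1)[of "f z"] True by (intro that[of "(A + psi s (f z)) / 2"]) auto
  next
    case False
    have "0 < s \<Longrightarrow> A < 0" using psi_sign(1)[OF _ pos(1)] psi_sign(1)[OF _ pos(2)] by (simp add: A_def)
    then show thesis
      using False by (intro that[of "if 0 < s then A / 2 else A + 1"]) auto
  qed
  have "s < 0 \<Longrightarrow> 0 < A" using psi_sign(2)[OF _ pos(1)] psi_sign(2)[OF _ pos(2)] by (simp add: A_def)
  then have pos_inv: "0 < psi_inv s T"
    using T by (cases s "0 :: real" rule: linorder_cases) (auto simp: psi_inv_pos_iff)
  define b where "b = psi_inv s T"
  have b: "0 < b" "psi s b = T" using pos_inv by (simp_all add: b_def psi_psi_inv)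
  have "f z < b"
  proof (cases "0 < f z")
    case True
    then have "\<not> psi s (f z) \<le> psi s b" using T(2) b(2) by simp
    then show ?thesis using True b(1) by (simp add: psi_le_iff)
  qed (use b(1) in simp)
  have \<eta>: "(\<lambda>k. 1 / real (Suc k)) \<longlonglongrightarrow> 0" by (rule LIMSEQ_Suc[OF lim_1_over_n])
  have R: "\<forall>\<^sub>F k in sequentially. c \<le> real (Suc k)" for c
    using eventually_ge_at_top[of "nat \<lceil>c\<rceil>"] by eventually_elim linarith
  have "(\<lambda>k. psi s (f x - 1 / real (Suc k))) \<longlonglongrightarrow> psi s (f x - 0)" if "0 < f x" for x
    by (intro isCont_tendsto_compose[OF isCont_psi] tendsto_intros \<eta>) (use that in simp)
  then have "(\<lambda>k. (psi s (f x - 1 / real (Suc k)) + psi s (f y - 1 / real (Suc k))) / 2 + 1 / real (Suc k))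
      \<longlonglongrightarrow> (psi s (f x - 0) + psi s (f y - 0)) / 2 + 0"
    using pos by (intro tendsto_intros \<eta>) auto
  then have lim: "(\<lambda>k. (psi s (f x - 1 / real (Suc k)) + psi s (f y - 1 / real (Suc k))) / 2 + 1 / real (Suc k)) \<longlonglongrightarrow> A"
    by (simp add: A_def)
  have small: "\<forall>\<^sub>F k in sequentially. 1 / real (Suc k) < c" if "0 < c" for c
    using order_tendstoD(2)[OF \<eta> that] .
  have "0 < b - f z" "0 < f x / 2" "0 < f y / 2" using \<open>f z < b\<close> pos by auto
  note smalls = this[THEN small]
  have "\<forall>\<^sub>F k in sequentially. (x, y) \<in> uniform_violations s f (1 / real (Suc k)) (real (Suc k))"
    using order_tendstoD(2)[OF lim T(1)] smalls
      R[of "norm x"] R[of "norm y"] R[of "f x"] R[of "f y"] R[of "f z"]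
  proof eventually_elim
    case (elim k)
    have "T = psi s b" by (simp add: b)
    also have "\<dots> \<le> psi s (f z + 1 / real (Suc k))"
      using elim nn[of z] by (intro psi_antimono) (auto intro: add_nonneg_pos)
    finally show ?case using elim by (simp add: uniform_violations_def z_def)
  qed
  then show ?thesis by (auto simp: eventually_sequentially)
qed

theorem sup_sum_entropy_eq_imp_s_concave:
  fixes f :: "'a::euclidean_space \<Rightarrow> real"
  assumes r: "r > 1 - 1 / real DIM('a)" "0 < r" and f: "prob_density f" and n: "n \<ge> 2"
    and fin: "renyi_entropy_defined r f" "renyi_entropy r f < \<infinity>"
    and sup: "sup_sum_entropy r n f midpoint_weights \<le> renyi_entropy r f"
  shows "s_concave_density (r - 1) f"
proof (rule AE_midpoint_concave_imp_s_concave_density)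
  have "AE x in lborel. \<forall>k. AE y in lborel. (x, y) \<notin> uniform_violations (r - 1) f (1 / real (Suc k)) (real (Suc k))"
    using uniform_violations_null[OF r(2) f n integrable_phi_of_sup_eq[OF f n fin sup] sup]
    by (subst AE_all_countable) simp
  then show "AE x in lborel. AE y in lborel. 0 < f x \<and> 0 < f y \<longrightarrow>
      0 < f (midpoint x y) \<and> psi (r - 1) (f (midpoint x y)) \<le> (psi (r - 1) (f x) + psi (r - 1) (f y)) / 2"
  proof eventually_elim
    case (elim x)
    then have "AE y in lborel. \<forall>k. (x, y) \<notin> uniform_violations (r - 1) f (1 / real (Suc k)) (real (Suc k))"
      by (simp add: AE_all_countable)
    then show ?case
      by eventually_elim (use midpoint_failure_imp_uniform_violation[of f, OF prob_density_nonneg[OF f]] in blast)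
  qed
qed (use r f in \<open>auto simp: prob_density_def\<close>)

theorem theorem4:
  fixes f :: "'a::euclidean_space \<Rightarrow> real" and r :: real and n :: nat
  assumes "r > 1 - 1 / real DIM('a)"
    and "prob_density f"
    and "n \<ge> 2"
  shows "(s_concave_density (r - 1) f \<longrightarrow>
            (\<forall>l. (\<forall>i\<in>{1..n}. 0 \<le> l i) \<and> (\<Sum>i=1..n. l i) = 1 \<longrightarrow>
               sup_sum_entropy r n f l = renyi_entropy r f))
       \<and> (renyi_entropy_defined r f \<and> renyi_entropy r f < \<infinity> \<longrightarrow>
            ((\<forall>l. (\<forall>i\<in>{1..n}. 0 \<le> l i) \<and> (\<Sum>i=1..n. l i) = 1 \<longrightarrow>
                sup_sum_entropy r n f l = renyi_entropy r f)
             \<longleftrightarrow> s_concave_density (r - 1) f))"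
proof -
  have "1 / real DIM('a) \<le> 1" by (simp add: DIM_ge_Suc0)
  with assms(1) have r: "0 < r" by linarith
  have forward: "sup_sum_entropy r n f l = renyi_entropy r f"
    if "s_concave_density (r - 1) f" "\<forall>i\<in>{1..n}. 0 \<le> l i" "(\<Sum>i=1..n. l i) = 1" for l
    using that by (intro s_concave_imp_sup_sum_entropy_eq[OF r assms(2)]) auto
  moreover have "s_concave_density (r - 1) f"
    if "renyi_entropy_defined r f" "renyi_entropy r f < \<infinity>"
      "\<forall>l. (\<forall>i\<in>{1..n}. 0 \<le> l i) \<and> (\<Sum>i=1..n. l i) = 1 \<longrightarrow> sup_sum_entropy r n f l = renyi_entropy r f"
  proof (rule sup_sum_entropy_eq_imp_s_concave[OF assms(1) r assms(2,3) that(1,2)])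
    have "\<forall>i\<in>{1..n}. 0 \<le> midpoint_weights i" by (simp add: midpoint_weights_def)
    then show "sup_sum_entropy r n f midpoint_weights \<le> renyi_entropy r f"
      using that(3) midpoint_weights_real_sum[OF assms(3)] by simp
  qed
  ultimately show ?thesis by blast
qed

end
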